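(* For every planar graph $G$ with girth at least 5, $\chi^\star_c(G)\le 4$; moreover the value 4 is optimal, i.e. there exists a planar graph $G$ of girth at least 5 with $\chi^\star_c(G)=4$.
   Context: Graphs are finite and simple. For a positive integer $k$, a $k$-cover of a graph $G$ is a pair $(\vec D,\sigma)$ where $\vec D$ is an orientation of $G$ and $\sigma$ assigns to each arc of $\vec D$ a permutation of $[k]=\{1,\dots,k\}$. A $(\vec D,\sigma)$-coloring is a map $\varphi:V(G)\to[k]$ with $\sigma(vw)(\varphi(v))\ne\varphi(w)$ for every arc $vw$ of $\vec D$. A $(\vec D,\sigma)$-packing is a collection $\varphi_1,\dots,\varphi_k$ of $(\vec D,\sigma)$-colorings such that $\varphi_i(v)\ne\varphi_j(v)$ for every vertex $v$ and all distinct $i,j\in[k]$. The correspondence packing number $\chi^\star_c(G)$ is the minimum $k$ such that $G$ has a $(\vec D,\sigma)$-packing for every $k$-cover of $G$. The girth of a graph is the length of its shortest cycle (infinite for forests). *)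

theory Defs
  imports
    "HOL-Analysis.Analysis"
    "HOL-Combinatorics.Permutations"
    "HOL-Library.Extended_Nat"
    "Graph_Theory.Pair_Digraph"
begin

text \<open>
  A finite simple graph is a \<open>pair_graph\<close>: a finite, loop-free, symmetric digraph without
  parallel arcs. The edge \<open>uv\<close> is represented by the two arcs \<open>(u,v)\<close> and \<open>(v,u)\<close>.
\<close>

subsection \<open>Girth\<close>

text \<open>
  The closed walk \<open>u, v, u\<close> along a single edge is a \<open>cycle\<close> of the symmetric digraph but not of
  the graph; the length restriction excludes exactly these. The infimum of the empty set is \<open>\<infinity>\<close>.
\<close>

definition girth :: "'a pair_pre_digraph \<Rightarrow> enat" where
  "girth G = Inf {enat (length p) | p. pre_digraph.cycle (with_proj G) p \<and> 3 \<le> length p}"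

subsection \<open>Planarity\<close>

text \<open>
  Edges are drawn as simple non-closed curves. The curve \<open>\<gamma> {u,v}\<close> belongs to the undirected edge,
  so its direction of traversal is left open.
\<close>

definition plane_drawing ::
  "'a pair_pre_digraph \<Rightarrow> ('a \<Rightarrow> complex) \<Rightarrow> ('a set \<Rightarrow> real \<Rightarrow> complex) \<Rightarrow> bool" where
  "plane_drawing G pos \<gamma> \<longleftrightarrow>
     inj_on pos (pverts G) \<and>
     (\<forall>(u, v) \<in> parcs G.
        arc (\<gamma> {u, v}) \<and>
        {pathstart (\<gamma> {u, v}), pathfinish (\<gamma> {u, v})} = {pos u, pos v} \<and>
        (\<forall>w \<in> pverts G. pos w \<in> path_image (\<gamma> {u, v}) \<longrightarrow> w \<in> {u, v})) \<and>
     (\<forall>(u, v) \<in> parcs G. \<forall>(x, y) \<in> parcs G. {u, v} \<noteq> {x, y} \<longrightarrow>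
        path_image (\<gamma> {u, v}) \<inter> path_image (\<gamma> {x, y}) \<subseteq> pos ` ({u, v} \<inter> {x, y}))"

definition planar :: "'a pair_pre_digraph \<Rightarrow> bool" where
  "planar G \<longleftrightarrow> (\<exists>pos \<gamma>. plane_drawing G pos \<gamma>)"

subsection \<open>Correspondence packing\<close>

definition orientation :: "'a pair_pre_digraph \<Rightarrow> ('a \<times> 'a) set \<Rightarrow> bool" where
  "orientation G D \<longleftrightarrow>
     D \<subseteq> parcs G \<and> (\<forall>(u, v) \<in> parcs G. (u, v) \<in> D \<longleftrightarrow> (v, u) \<notin> D)"

definition cover ::
  "nat \<Rightarrow> 'a pair_pre_digraph \<Rightarrow> ('a \<times> 'a) set \<Rightarrow> ('a \<times> 'a \<Rightarrow> nat \<Rightarrow> nat) \<Rightarrow> bool" where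
  "cover k G D \<sigma> \<longleftrightarrow> orientation G D \<and> (\<forall>a \<in> D. \<sigma> a permutes {1..k})"

definition cover_coloring ::
  "nat \<Rightarrow> 'a pair_pre_digraph \<Rightarrow> ('a \<times> 'a) set \<Rightarrow> ('a \<times> 'a \<Rightarrow> nat \<Rightarrow> nat) \<Rightarrow> ('a \<Rightarrow> nat) \<Rightarrow> bool" where
  "cover_coloring k G D \<sigma> \<phi> \<longleftrightarrow>
     (\<forall>v \<in> pverts G. \<phi> v \<in> {1..k}) \<and> (\<forall>(v, w) \<in> D. \<sigma> (v, w) (\<phi> v) \<noteq> \<phi> w)"

definition cover_packing ::
  "nat \<Rightarrow> 'a pair_pre_digraph \<Rightarrow> ('a \<times> 'a) set \<Rightarrow> ('a \<times> 'a \<Rightarrow> nat \<Rightarrow> nat) \<Rightarrow> (nat \<Rightarrow> 'a \<Rightarrow> nat) \<Rightarrow> bool" where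
  "cover_packing k G D \<sigma> \<Phi> \<longleftrightarrow>
     (\<forall>i \<in> {1..k}. cover_coloring k G D \<sigma> (\<Phi> i)) \<and>
     (\<forall>v \<in> pverts G. \<forall>i \<in> {1..k}. \<forall>j \<in> {1..k}. i \<noteq> j \<longrightarrow> \<Phi> i v \<noteq> \<Phi> j v)"

text \<open>
  The infimum in \<open>enat\<close> of a nonempty set is its minimum; should no \<open>k\<close> qualify, the value is \<open>\<infinity>\<close>
  rather than an unspecified number.
\<close>

definition corr_packing_number :: "'a pair_pre_digraph \<Rightarrow> enat" where
  "corr_packing_number G =
     Inf {enat k | k. 1 \<le> k \<and> (\<forall>D \<sigma>. cover k G D \<sigma> \<longrightarrow> (\<exists>\<Phi>. cover_packing k G D \<sigma> \<Phi>))}"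

end

theory Submission
  imports Defs "HOL-Complex_Analysis.Contour_Integration"
begin

text \<open>
  A packing by four colorings assigns to every vertex a permutation of \<open>{1..4}\<close>, and an edge asks
  two such permutations to be disjoint after relabelling. A vertex of degree at most two can
  always be added to a packing. So can a path of three vertices of degree three: the middle vertex
  has nine candidates for its single outer neighbour, and at most four of them are blocked by
  either end vertex. Every nonempty planar graph of girth at least 5 satisfies \<open>3 e < 5 n\<close>, and
  discharging then shows that one of the two configurations occurs.

  The bound \<open>3 e < 5 n\<close> follows from Euler's formula. For curves that are merely continuous, the
  two halves of the face count are proved with the Jordan curve theorem, by which an edge closing
  a cycle splits a face, and Janiszewski's theorem, by which it splits it into at most two parts
  and a forest does not separate the plane.

  Optimality is witnessed by the 5-cycle: disjoint permutations of three elements have the same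
  parity, so a cover with exactly one odd permutation has no packing by three colorings.
\<close>

section \<open>Arcs and the components of a plane complement\<close>

text \<open>For merely continuous curves neither boundary walks nor finiteness of the set of faces
  comes for free. A finite set of points in pairwise different components therefore stands for the
  faces, and only the inequality \<open>card E + 2 <= card P + card V\<close> of Euler's formula is
  established. The length of a face boundary is replaced by the number of edges whose removal joins
  the face to another one. Deleting all other edges leaves the face separated, so these edges do not
  form a forest and the girth makes them at least five, while each edge serves at most two faces.
  With two or more representatives, \<open>5 * card P <= 2 * card E\<close> then gives
  \<open>3 * card E + 10 <= 5 * card V\<close>. The bound is proved for every induced subgraph,
  because the induction that builds the packing deletes vertices. Nine is the number of derangements
  of four elements. That an end vertex blocks at most four of them is found by exhaustive
  evaluation, and 4 + 4 < 9 leaves a choice for the middle vertex.\<close>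

definition separated_by :: "complex set \<Rightarrow> complex set \<Rightarrow> bool" where
  "separated_by A P \<longleftrightarrow> P \<inter> A = {} \<and> (\<forall>x\<in>P. \<forall>y\<in>P. x \<noteq> y \<longrightarrow> \<not> connected_component (- A) x y)"

text \<open>This supplies the closed curve for the Jordan curve theorem. A path inside
  \<open>A\<close> between the ends of \<open>g\<close> contains an arc, which meets
  \<open>g\<close> only at these ends because \<open>g\<close> meets \<open>A\<close> nowhere
  else.\<close>

lemma closing_arc:
  fixes g :: "real \<Rightarrow> complex"
  assumes "arc g" "path_image g \<inter> A = {pathstart g, pathfinish g}"
    and "path_component A (pathfinish g) (pathstart g)"
  obtains b where "arc b" "path_image b \<subseteq> A" "simple_path (g +++ b)"
    "pathfinish (g +++ b) = pathstart (g +++ b)"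
    "path_image (g +++ b) = path_image g \<union> path_image b"
    "pathfinish g \<in> path_image b" "pathstart g \<in> path_image b"
proof -
  obtain q where q: "path q" "path_image q \<subseteq> A" "pathstart q = pathfinish g" "pathfinish q = pathstart g"
    using assms(3) by (auto simp: path_component_def)
  then obtain b where b: "arc b" "path_image b \<subseteq> path_image q" "pathstart b = pathfinish g" "pathfinish b = pathstart g"
    using path_contains_arc[of q "pathfinish g" "pathstart g"] arc_distinct_ends[OF assms(1)]
    by metis
  show ?thesis
  proof
    show "simple_path (g +++ b)"
      using assms b q by (intro simple_path_join_loop) auto
    show "path_image (g +++ b) = path_image g \<union> path_image b"
      using b by (intro path_image_join) auto
    show "pathfinish g \<in> path_image b" "pathstart g \<in> path_image b"
      using b(3,4) pathstart_in_path_image[of b] pathfinish_in_path_image[of b] by auto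
  qed (use b q in auto)
qed

text \<open>Without its ends an arc is still connected, so the new arc runs inside a single face of
  \<open>A\<close>.\<close>

lemma arc_interior_connected:
  fixes g :: "real \<Rightarrow> complex"
  assumes "arc g" "path_image g \<inter> A = {pathstart g, pathfinish g}"
    and "z \<in> path_image g - A" "z' \<in> path_image g - A"
  shows "connected_component (- A) z z'"
proof -
  have "connected (path_image g - {pathstart g, pathfinish g})"
    using assms(1) by (intro connected_simple_path_endless arc_imp_simple_path)
  moreover have "path_image g - {pathstart g, pathfinish g} = path_image g - A"
    using assms(2) by auto
  ultimately show ?thesis
    using assms(3,4) unfolding connected_component_def by (intro exI[of _ "path_image g - A"]) auto
qed

text \<open>Both sides of the Jordan curve accumulate at every point of the open arc. A small ball
  there avoids \<open>A\<close>, so \<open>x\<close> and \<open>y\<close> can be taken on different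
  sides but in one face of \<open>A\<close>. The last conclusion records that the face being cut is
  the one containing the open arc.\<close>

lemma arc_splits_face:
  fixes g :: "real \<Rightarrow> complex"
  assumes "closed A" and g: "arc g" "path_image g \<inter> A = {pathstart g, pathfinish g}"
    and "path_component A (pathfinish g) (pathstart g)"
  obtains x y where "x \<notin> A \<union> path_image g" "y \<notin> A \<union> path_image g"
    "\<not> connected_component (- (A \<union> path_image g)) x y"
    "connected_component (- A) x y" "\<And>z. z \<in> path_image g - A \<Longrightarrow> connected_component (- A) z x"
proof -
  obtain b where b: "arc b" "path_image b \<subseteq> A" "simple_path (g +++ b)"
    "pathfinish (g +++ b) = pathstart (g +++ b)"
    "path_image (g +++ b) = path_image g \<union> path_image b"
    using closing_arc assms by metis
  obtain inner outer where J: "open inner" "open outer" "inner \<inter> outer = {}"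
    "inner \<union> outer = - path_image (g +++ b)" "frontier inner = path_image (g +++ b)"
    "frontier outer = path_image (g +++ b)"
    using Jordan_curve[OF b(3,4)] by metis
  have "path_image g - {pathstart g, pathfinish g} \<noteq> {}"
    using g by (intro nonempty_simple_path_endless arc_imp_simple_path)
  then obtain z where z: "z \<in> path_image g" "z \<notin> A"
    using g(2) by auto
  then obtain e where e: "e > 0" "ball z e \<subseteq> - A"
    using \<open>closed A\<close> by (metis ComplI open_Compl open_contains_ball)
  have "z \<in> closure inner" "z \<in> closure outer"
    using J(5,6) b(5) z by (auto simp: frontier_def)
  then obtain x y where xy: "x \<in> inner" "x \<in> ball z e" "y \<in> outer" "y \<in> ball z e"
    using e(1) by (metis closure_approachable dist_commute mem_ball)
  show ?thesis
  proof
    show "x \<notin> A \<union> path_image g" "y \<notin> A \<union> path_image g"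
      using xy e J(4) b(5) by auto
    have zx: "connected_component (- A) z x" "connected_component (- A) z y"
      using e xy by (auto simp: connected_component_def intro!: exI[of _ "ball z e"])
    show "connected_component (- A) x y"
      using zx connected_component_sym connected_component_trans by metis
    show "connected_component (- A) w x" if "w \<in> path_image g - A" for w
      using arc_interior_connected[OF g that, of z] z zx connected_component_trans by blast
    show "\<not> connected_component (- (A \<union> path_image g)) x y"
    proof
      assume "connected_component (- (A \<union> path_image g)) x y"
      then obtain T where T: "connected T" "T \<subseteq> - (A \<union> path_image g)" "x \<in> T" "y \<in> T"
        by (auto simp: connected_component_def)
      then have "T \<subseteq> inner \<union> outer"
        using J(4) b(2,5) by auto
      then show False
        using connectedD[OF T(1) J(1,2)] J(3) T(3,4) xy(1,3) by blast
    qed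
  qed
qed

lemma separated_by_add_arc:
  fixes g :: "real \<Rightarrow> complex"
  assumes "closed A" and g: "arc g" "path_image g \<inter> A = {pathstart g, pathfinish g}"
    and "path_component A (pathfinish g) (pathstart g)"
    and P: "finite P" "separated_by A P"
  obtains P' where "finite P'" "separated_by (A \<union> path_image g) P'" "card P' \<ge> Suc (card P)"
proof -
  obtain x y where xy: "x \<notin> A \<union> path_image g" "y \<notin> A \<union> path_image g"
    "\<not> connected_component (- (A \<union> path_image g)) x y"
    "connected_component (- A) x y" "\<And>z. z \<in> path_image g - A \<Longrightarrow> connected_component (- A) z x"
    using arc_splits_face[OF assms(1-4)] by metis
  \<comment> \<open>At most one representative lies in the face that is cut. It is dropped and one
    point on each side of the cut is added, a net gain of at least one. The representatives in
    \<open>Q\<close> lie in faces that the open arc does not meet.\<close>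
  define Q where "Q = {p\<in>P. \<not> connected_component (- A) p x}"
  have Q: "Q \<subseteq> P" "finite Q"
    using P(1) by (auto simp: Q_def)
  have "p = q" if "p \<in> P - Q" "q \<in> P - Q" for p q
    using that P(2) connected_component_sym connected_component_trans
    unfolding Q_def separated_by_def by (smt (verit) DiffE mem_Collect_eq)
  then have "card (P - Q) \<le> 1"
    by (metis card_le_Suc0_iff_eq finite_Diff P(1) One_nat_def)
  then have cQ: "card P \<le> Suc (card Q)"
    using Q P(1) by (simp add: card_Diff_subset)
  have xQ: "\<not> connected_component (- A) p x" "\<not> connected_component (- A) p y" if "p \<in> Q" for p
    using that xy(4) connected_component_sym connected_component_trans unfolding Q_def by blast+
  have sub: "- (A \<union> path_image g) \<subseteq> - A" by auto
  have xx: "connected_component (- A) x x" "connected_component (- A) y y"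
    using xy by (auto simp: connected_component_refl_eq)
  have "x \<noteq> y"
    using xy(1,3) by (auto simp: connected_component_refl_eq)
  moreover have "x \<notin> Q" "y \<notin> Q"
    using xQ xx by blast+
  ultimately have "card (insert x (insert y Q)) \<ge> Suc (card P)"
    using cQ Q by simp
  moreover have "separated_by (A \<union> path_image g) (insert x (insert y Q))"
  proof -
    have "Q \<inter> (A \<union> path_image g) = {}"
      using P(2) Q xy(5) by (auto simp: separated_by_def Q_def)
    moreover have "\<not> connected_component (- (A \<union> path_image g)) p q" if "p \<in> Q" "q \<in> Q" "p \<noteq> q" for p q
      using that P(2) Q connected_component_of_subset[OF _ sub] unfolding separated_by_def by blast
    moreover have "\<not> connected_component (- (A \<union> path_image g)) p x"
      "\<not> connected_component (- (A \<union> path_image g)) p y" if "p \<in> Q" for p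
      using that xQ connected_component_of_subset[OF _ sub] by blast+
    ultimately show ?thesis
      using xy(1-3) connected_component_sym unfolding separated_by_def by blast
  qed
  ultimately show ?thesis
    using Q by (intro that[of "insert x (insert y Q)"]) auto
qed

text \<open>Each side of the Jordan curve contains at most one piece of the face: the curve meets
  \<open>A\<close> in the connected set \<open>path_image b\<close>, so by Janiszewski's theorem
  points joined off \<open>A\<close> and joined off the curve are joined off the union. Of three
  points, two lie on the same side.\<close>

lemma arc_splits_at_most_two:
  fixes g :: "real \<Rightarrow> complex"
  assumes "compact A" and g: "arc g" "path_image g \<inter> A = {pathstart g, pathfinish g}"
    and "path_component A (pathfinish g) (pathstart g)"
    and abc: "connected_component (- A) x y" "connected_component (- A) x z"
    and "x \<notin> path_image g" "y \<notin> path_image g" "z \<notin> path_image g"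
  shows "connected_component (- (A \<union> path_image g)) x y
    \<or> connected_component (- (A \<union> path_image g)) x z \<or> connected_component (- (A \<union> path_image g)) y z"
proof -
  obtain b where b: "arc b" "path_image b \<subseteq> A" "simple_path (g +++ b)"
    "pathfinish (g +++ b) = pathstart (g +++ b)"
    "path_image (g +++ b) = path_image g \<union> path_image b"
    "pathfinish g \<in> path_image b" "pathstart g \<in> path_image b"
    using closing_arc assms by metis
  obtain inner outer where J: "connected inner" "connected outer"
    "inner \<union> outer = - path_image (g +++ b)"
    using Jordan_curve[OF b(3,4)] by metis
  let ?J = "path_image (g +++ b)"
  have glue: "connected_component (- (A \<union> path_image g)) p q"
    if "connected_component (- A) p q" "connected_component (- ?J) p q" for p q
  proof -
    have "path_image g \<inter> A \<subseteq> path_image b"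
      using b(6,7) g(2) by simp
    then have "A \<inter> ?J = path_image b"
      using b(2,5) by blast
    then have "connected_component (- (A \<union> ?J)) p q"
      using that assms(1) b(1,3)
      by (intro Janiszewski) (auto simp: closed_simple_path_image connected_arc_image simp del: path_image_join)
    moreover have "A \<union> ?J = A \<union> path_image g"
      using b by auto
    ultimately show ?thesis by simp
  qed
  have "{x, y, z} \<subseteq> - A"
    using abc connected_component_in by fastforce
  then have "{x, y, z} \<subseteq> inner \<union> outer"
    using assms(7-) b J(3) by auto
  moreover have "connected_component (- ?J) p q" if "{p, q} \<subseteq> inner \<or> {p, q} \<subseteq> outer" for p q
    using that J unfolding connected_component_def by (metis Un_upper1 Un_upper2 insert_subset)
  ultimately have "connected_component (- ?J) x y \<or> connected_component (- ?J) x z \<or> connected_component (- ?J) y z"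
    by blast
  moreover have "connected_component (- A) y z"
    using abc connected_component_sym connected_component_trans by blast
  ultimately show ?thesis
    using glue abc by blast
qed

text \<open>Janiszewski's theorem applies twice, each time with a single point as intersection:
  first to \<open>A\<close> and the arc, which alone does not separate the plane, then to
  \<open>B\<close> and the union of both.\<close>

lemma arc_add_bridge:
  fixes g :: "real \<Rightarrow> complex"
  assumes "compact A" "compact B" "arc g" "A \<inter> B = {}"
    "path_image g \<inter> A = {p}" "path_image g \<inter> B = {q}"
    and ab: "connected_component (- (A \<union> B)) x y"
    and "x \<notin> path_image g" "y \<notin> path_image g"
  shows "connected_component (- (A \<union> B \<union> path_image g)) x y"
proof -
  have "connected (- path_image g)"
    using assms(3) by (intro connected_arc_complement) auto
  then have 1: "connected_component (- path_image g) x y"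
    using assms(8,9) by (auto simp: connected_component_def)
  have "connected_component (- (A \<union> path_image g)) x y"
  proof (rule Janiszewski)
    show "connected (A \<inter> path_image g)"
      using assms(5) by (simp add: Int_commute)
  qed (use assms 1 in \<open>auto simp: closed_arc_image intro: connected_component_of_subset[OF ab]\<close>)
  note * = this
  have "connected_component (- (B \<union> (A \<union> path_image g))) x y"
  proof (rule Janiszewski)
    have "B \<inter> (A \<union> path_image g) = {q}"
      using assms(4,6) by blast
    then show "connected (B \<inter> (A \<union> path_image g))"
      by simp
    show "connected_component (- B) x y"
      using ab by (rule connected_component_of_subset) auto
  qed (use assms * in \<open>auto simp: closed_arc_image compact_imp_closed\<close>)
  then show ?thesis
    by (simp add: Un_ac)
qed

text \<open>Adding \<open>B\<close> to \<open>A\<close> shrinks the component of \<open>x\<close>,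
  so the smaller component has a boundary point inside the larger one. That point belongs to
  \<open>B\<close>, since a ball around a point off the closed set \<open>A \<union> B\<close> would
  extend the component. With \<open>B\<close> an edge, this finds a point of the open edge on the
  border of a given face.\<close>

lemma component_frontier_meets_removed:
  fixes A B :: "complex set"
  assumes "closed A" "closed B"
    and "connected_component (- A) x y" "\<not> connected_component (- (A \<union> B)) x y" "x \<notin> B"
  obtains w where "w \<in> B - A" "connected_component (- A) x w"
    "w \<in> closure (connected_component_set (- (A \<union> B)) x)"
proof -
  define U where "U = connected_component_set (- (A \<union> B)) x"
  define C where "C = connected_component_set (- A) x"
  have "x \<notin> A"
    using assms(3) connected_component_in by fastforce
  then have x: "x \<in> U" "x \<in> C"
    using assms(5) by (auto simp: U_def C_def connected_component_refl_eq)
  have UC: "U \<subseteq> C"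
    unfolding U_def C_def by (intro connected_component_mono) auto
  have "open U"
    unfolding U_def using assms by (intro open_connected_component) auto
  have "connected C" "open C"
    unfolding C_def using assms(1) by (auto intro: open_connected_component)
  have "y \<in> C" "y \<notin> U"
    using assms(3,4) by (auto simp: U_def C_def)
  have "\<exists>w. w \<in> C \<and> w \<in> closure U \<and> w \<notin> U"
  proof (rule ccontr)
    assume "\<not> ?thesis"
    then have "C \<subseteq> U \<union> - closure U"
      by auto
    then show False
      using connectedD[OF \<open>connected C\<close> \<open>open U\<close>, of "- closure U"] x \<open>y \<in> C\<close> \<open>y \<notin> U\<close> closure_subset[of U]
      by auto
  qed
  then obtain w where w: "w \<in> C" "w \<in> closure U" "w \<notin> U"
    by blast
  have "C \<subseteq> - A"
    unfolding C_def by (rule connected_component_subset)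
  have "w \<in> B"
  proof (rule ccontr)
    assume "w \<notin> B"
    then have "w \<in> - (A \<union> B)"
      using w \<open>C \<subseteq> - A\<close> by auto
    moreover have "open (- (A \<union> B))"
      using assms by auto
    ultimately obtain d where d: "d > 0" "ball w d \<subseteq> - (A \<union> B)"
      by (metis open_contains_ball)
    then obtain x'' where "x'' \<in> U" "x'' \<in> ball w d"
      using w by (metis closure_approachable dist_commute mem_ball)
    moreover from this have "connected_component (- (A \<union> B)) x'' w"
      using d by (auto simp: connected_component_def intro!: exI[of _ "ball w d"])
    ultimately have "w \<in> U"
      unfolding U_def using connected_component_trans by (metis mem_Collect_eq)
    with w show False by simp
  qed
  show ?thesis
  proof
    show "w \<in> B - A"
      using \<open>w \<in> B\<close> w \<open>C \<subseteq> - A\<close> by auto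
    show "connected_component (- A) x w" "w \<in> closure (connected_component_set (- (A \<union> B)) x)"
      using w by (auto simp: U_def C_def)
  qed
qed

text \<open>The inverse of \<open>g\<close> would map a nonempty open set of the plane continuously
  and injectively into the line, against invariance of dimension.\<close>

lemma interior_arc_image_empty:
  fixes g :: "real \<Rightarrow> complex"
  assumes "arc g"
  shows "interior (path_image g) = {}"
proof (rule ccontr)
  assume ne: "interior (path_image g) \<noteq> {}"
  obtain h where h: "homeomorphism {0..1} (path_image g) g h"
    using homeomorphism_arc[OF assms] by blast
  have "continuous_on (interior (path_image g)) h" "inj_on h (interior (path_image g))"
    using h interior_subset[of "path_image g"] unfolding homeomorphism_def
    by (meson continuous_on_subset, metis inj_on_def subsetD)
  then have "DIM(complex) \<le> DIM(real)"
    using ne by (intro invariance_of_dimension) auto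
  then show False by simp
qed

text \<open>A new curve may run through a representative. Faces are open and a set without interior
  cannot cover one, so each representative can be moved off \<open>B\<close> within its
  face.\<close>

lemma separated_by_perturb:
  assumes "closed A" "interior B = {}" "separated_by A P" "finite P"
  obtains P' where "finite P'" "separated_by (A \<union> B) P'" "card P' = card P"
proof -
  have "\<exists>y. connected_component (- A) x y \<and> y \<notin> B" if "x \<in> P" for x
  proof -
    have "open (connected_component_set (- A) x)"
      using assms(1) by (intro open_connected_component) auto
    moreover have "x \<in> connected_component_set (- A) x"
      using that assms(3) by (auto simp: separated_by_def)
    ultimately have "\<not> connected_component_set (- A) x \<subseteq> B"
      using assms(2) interior_maximal by blast
    then show ?thesis by auto
  qed
  then obtain f where f: "\<And>x. x \<in> P \<Longrightarrow> connected_component (- A) x (f x)" "\<And>x. x \<in> P \<Longrightarrow> f x \<notin> B"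
    by metis
  have sep: "\<not> connected_component (- A) (f x) (f y)" if "x \<in> P" "y \<in> P" "x \<noteq> y" for x y
    using that f(1) assms(3) connected_component_sym connected_component_trans
    unfolding separated_by_def by metis
  have fA: "f x \<notin> A" if "x \<in> P" for x
    using f(1)[OF that] connected_component_in by fastforce
  have "inj_on f P"
    using sep fA by (metis ComplI connected_component_refl inj_onI)
  then have "card (f ` P) = card P"
    by (rule card_image)
  moreover have "separated_by (A \<union> B) (f ` P)"
    unfolding separated_by_def
  proof (intro conjI ballI impI)
    show "f ` P \<inter> (A \<union> B) = {}"
      using f(2) fA by auto
    show "\<not> connected_component (- (A \<union> B)) x y" if "x \<in> f ` P" "y \<in> f ` P" "x \<noteq> y" for x y
      using that sep connected_component_of_subset[of "- (A \<union> B)" x y "- A"] by auto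
  qed
  ultimately show ?thesis
    using assms(4) by (intro that[of "f ` P"]) auto
qed

section \<open>Counting the faces of a plane graph\<close>

text \<open>Minimum degree two, expressed by edges alone. A nonempty finite edge set of this kind
  contains a cycle, and forests are the edge sets without a nonempty leaf-free subset. The notion
  replaces cycles throughout the planar part.\<close>

definition leaf_free :: "'a set set \<Rightarrow> bool" where
  "leaf_free F \<longleftrightarrow> (\<forall>e\<in>F. \<forall>v\<in>e. \<exists>f\<in>F. f \<noteq> e \<and> v \<in> f)"

locale plane_graph =
  fixes V :: "'a set" and E :: "'a set set"
    and pos :: "'a \<Rightarrow> complex" and \<gamma> :: "'a set \<Rightarrow> real \<Rightarrow> complex"
  assumes finite_V: "finite V"
    and edge: "e \<in> E \<Longrightarrow> \<exists>u v. u \<noteq> v \<and> u \<in> V \<and> v \<in> V \<and> e = {u, v}"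
    and inj_pos: "inj_on pos V"
    and arc_edge: "e \<in> E \<Longrightarrow> arc (\<gamma> e)"
    and edge_ends: "e \<in> E \<Longrightarrow> {pathstart (\<gamma> e), pathfinish (\<gamma> e)} = pos ` e"
    and vertex_on_edge: "e \<in> E \<Longrightarrow> w \<in> V \<Longrightarrow> pos w \<in> path_image (\<gamma> e) \<Longrightarrow> w \<in> e"
    and edges_cross: "e \<in> E \<Longrightarrow> f \<in> E \<Longrightarrow> e \<noteq> f \<Longrightarrow>
      path_image (\<gamma> e) \<inter> path_image (\<gamma> f) \<subseteq> pos ` (e \<inter> f)"
begin

text \<open>All vertices belong to the drawing, whatever \<open>F\<close> is, so that a further edge
  meets it exactly in its two ends.\<close>

definition drawing :: "'a set set \<Rightarrow> complex set" where
  "drawing F = pos ` V \<union> (\<Union>e\<in>F. path_image (\<gamma> e))"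

lemma finite_E: "finite E"
proof (rule finite_subset)
  show "E \<subseteq> Pow V" using edge by fastforce
qed (use finite_V in auto)

text \<open>Intersecting with the image of \<open>V\<close> keeps the vertex part finite for
  arbitrary \<open>W\<close>. Drawings with some vertices left out are covered too, such as the two
  pieces joined by a bridge.\<close>

lemma compact_arcs:
  assumes "F \<subseteq> E"
  shows "compact (pos ` W \<inter> pos ` V \<union> (\<Union>e\<in>F. path_image (\<gamma> e)))"
proof (intro compact_Un compact_UN)
  show "compact (pos ` W \<inter> pos ` V)"
    using finite_V by (intro finite_imp_compact) auto
  show "finite F"
    using finite_E assms finite_subset by blast
  show "compact (path_image (\<gamma> e))" if "e \<in> F" for e
    using that assms arc_edge by (intro compact_arc_image) auto
qed

lemma compact_drawing: "F \<subseteq> E \<Longrightarrow> compact (drawing F)"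
  using compact_arcs[of F V] by (simp add: drawing_def)

lemma drawing_insert: "drawing (insert e F) = drawing F \<union> path_image (\<gamma> e)"
  by (auto simp: drawing_def)

lemma drawing_mono: "F \<subseteq> F' \<Longrightarrow> drawing F \<subseteq> drawing F'"
  by (auto simp: drawing_def)

lemma ends_in_image:
  assumes "e \<in> E"
  shows "pos ` e \<subseteq> path_image (\<gamma> e)"
  using edge_ends[OF assms] pathstart_in_path_image pathfinish_in_path_image by (metis empty_subsetI insert_subset)

lemma edge_subset: "e \<in> E \<Longrightarrow> e \<subseteq> V"
  using edge by fastforce

lemma edge_Int_drawing:
  assumes "e \<in> E" "F \<subseteq> E" "e \<notin> F"
  shows "path_image (\<gamma> e) \<inter> drawing F = {pathstart (\<gamma> e), pathfinish (\<gamma> e)}"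
proof -
  have "path_image (\<gamma> e) \<inter> drawing F \<subseteq> pos ` e"
  proof
    fix x assume x: "x \<in> path_image (\<gamma> e) \<inter> drawing F"
    then consider w where "w \<in> V" "x = pos w" | f where "f \<in> F" "x \<in> path_image (\<gamma> f)"
      by (auto simp: drawing_def)
    then show "x \<in> pos ` e"
    proof cases
      case 1
      then show ?thesis using x assms vertex_on_edge by auto
    next
      case 2
      then have "x \<in> pos ` (e \<inter> f)" using x assms edges_cross[of e f] by auto
      then show ?thesis by auto
    qed
  qed
  moreover have "pos ` e \<subseteq> drawing F"
    using edge_subset[OF assms(1)] by (auto simp: drawing_def)
  ultimately show ?thesis
    using ends_in_image[OF assms(1)] edge_ends[OF assms(1)] by auto
qed

lemma edge_cases:
  assumes "e \<in> E"
  obtains u v where "e = {u, v}" "u \<noteq> v" "u \<in> V" "v \<in> V" "pathstart (\<gamma> e) = pos u" "pathfinish (\<gamma> e) = pos v"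
proof -
  obtain u v where uv: "u \<noteq> v" "u \<in> V" "v \<in> V" "e = {u, v}"
    using edge[OF assms] by blast
  then have "{pathstart (\<gamma> e), pathfinish (\<gamma> e)} = {pos u, pos v}"
    using edge_ends[OF assms] by simp
  then consider "pathstart (\<gamma> e) = pos u" "pathfinish (\<gamma> e) = pos v"
    | "pathstart (\<gamma> e) = pos v" "pathfinish (\<gamma> e) = pos u"
    by (auto simp: doubleton_eq_iff)
  then show ?thesis
  proof cases
    case 1
    then show ?thesis using uv by (intro that[of u v]) auto
  next
    case 2
    then show ?thesis using uv by (intro that[of v u]) auto
  qed
qed

lemma path_component_edge:
  assumes "e \<in> F" "F \<subseteq> E" "x \<in> path_image (\<gamma> e)" "y \<in> path_image (\<gamma> e)"
  shows "path_component (drawing F) x y"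
proof -
  have "path_connected (path_image (\<gamma> e))"
    using assms arc_edge by (intro path_connected_path_image arc_imp_path) auto
  then have "path_component (path_image (\<gamma> e)) x y"
    using assms path_connected_component by blast
  then show ?thesis
    using assms(1) by (intro path_component_of_subset[of _ "drawing F"]) (auto simp: drawing_def)
qed

text \<open>Edges are added one at a time under a labelling \<open>c\<close> of the vertices, where
  equal labels certify a connection within the drawing. An edge between equal labels closes a cycle
  and yields a further face, and an edge between different labels lets two labels merge. Either way
  the inequality persists. At the start every vertex is its own label and there is one
  representative.\<close>

lemma many_faces:
  assumes "F \<subseteq> E"
  shows "\<exists>c P. (\<forall>u\<in>V. \<forall>v\<in>V. c u = c v \<longrightarrow> path_component (drawing F) (pos u) (pos v))
    \<and> finite P \<and> separated_by (drawing F) P \<and> card F + card ((c :: 'a \<Rightarrow> 'a) ` V) + 1 \<le> card P + card V"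
  using finite_subset[OF assms finite_E] assms
proof (induction F rule: finite_induct)
  case empty
  have "pos ` V \<noteq> UNIV"
    using finite_V infinite_UNIV_char_0[where 'a = complex] by (metis finite_imageI)
  then obtain x where "x \<notin> pos ` V"
    by auto
  then have "separated_by (drawing {}) {x}"
    by (auto simp: separated_by_def drawing_def)
  moreover have "path_component (drawing {}) (pos u) (pos u)" if "u \<in> V" for u
    using that by (intro path_component_refl) (auto simp: drawing_def)
  ultimately show ?case
    by (intro exI[of _ id] exI[of _ "{x}"]) auto
next
  case (insert e F)
  then obtain c P where
    c: "\<And>u v. u \<in> V \<Longrightarrow> v \<in> V \<Longrightarrow> (c :: 'a \<Rightarrow> 'a) u = c v \<Longrightarrow> path_component (drawing F) (pos u) (pos v)"
    and P: "finite P" "separated_by (drawing F) P" "card F + card (c ` V) + 1 \<le> card P + card V"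
    by (metis (no_types, lifting) insert_subset)
  have e: "e \<in> E" "F \<subseteq> E" "e \<notin> F"
    using insert by auto
  obtain u v where uv: "e = {u, v}" "u \<noteq> v" "u \<in> V" "v \<in> V"
    "pathstart (\<gamma> e) = pos u" "pathfinish (\<gamma> e) = pos v"
    using edge_cases[OF e(1)] .
  have clF: "closed (drawing F)"
    using compact_drawing[OF e(2)] by (rule compact_imp_closed)
  have sub: "drawing F \<subseteq> drawing (insert e F)"
    by (intro drawing_mono) auto
  show ?case
  proof (cases "c u = c v")
    case True
    then have "path_component (drawing F) (pathfinish (\<gamma> e)) (pathstart (\<gamma> e))"
      using c[of v u] uv by auto
    then obtain P' where "finite P'" "separated_by (drawing F \<union> path_image (\<gamma> e)) P'" "card P' \<ge> Suc (card P)"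
      using separated_by_add_arc[OF clF arc_edge[OF e(1)] edge_Int_drawing[OF e] _ P(1,2)] by blast
    then show ?thesis
      using P(3) c e(3) insert(1) path_component_of_subset[OF sub]
      by (intro exI[of _ c] exI[of _ P']) (auto simp: drawing_insert)
  next
    case False
    \<comment> \<open>The label of \<open>v\<close> is absorbed into that of \<open>u\<close>, and
      one label fewer pays for the new edge. The representatives are merely moved off it.\<close>
    define c' where "c' w = (if c w = c v then c u else c w)" for w
    have "c' ` V \<subseteq> c ` V - {c v}"
      using False uv by (auto simp: c'_def)
    then have "card (c' ` V) \<le> card (c ` V - {c v})"
      using finite_V by (intro card_mono) auto
    also have "\<dots> = card (c ` V) - 1"
      using finite_V uv by (intro card_Diff_singleton) auto
    finally have "card (c' ` V) + 1 \<le> card (c ` V)"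
      using finite_V uv by (metis One_nat_def Suc_leI add.commute card_gt_0_iff empty_iff finite_imageI imageI le_add_diff_inverse2 add_le_cancel_right)
    moreover obtain P' where "finite P'" "separated_by (drawing F \<union> path_image (\<gamma> e)) P'" "card P' = card P"
      using separated_by_perturb[OF clF interior_arc_image_empty[OF arc_edge[OF e(1)]] P(2,1)] .
    moreover have "path_component (drawing (insert e F)) (pos x) (pos y)" if "x \<in> V" "y \<in> V" "c' x = c' y" for x y
    proof -
      have *: "path_component (drawing (insert e F)) (pos x) (pos y)" if "x \<in> V" "y \<in> V" "c x = c y" for x y
        using c[OF that] sub by (rule path_component_of_subset[rotated])
      have uv': "path_component (drawing (insert e F)) (pos u) (pos v)"
        using e uv(1) ends_in_image[OF e(1)] by (intro path_component_edge[of e]) auto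
      show ?thesis
      proof (cases "c x = c y")
        case True
        then show ?thesis using * that by blast
      next
        case False
        then have "c x = c v \<and> c y = c u \<or> c x = c u \<and> c y = c v"
          using that(3) by (auto simp: c'_def split: if_splits)
        then show ?thesis
          using * uv' uv(3,4) that(1,2) path_component_sym path_component_trans by metis
      qed
    qed
    ultimately show ?thesis
      using P(3) e(3) insert(1) by (intro exI[of _ c'] exI[of _ P']) (auto simp: drawing_insert)
  qed
qed

text \<open>A nonempty forest has a leaf \<open>v\<close>. Its edge joins the compact rest of the
  drawing to the isolated point \<open>pos v\<close>, so adding it back is a case of
  \<open>arc_add_bridge\<close>.\<close>

lemma forest_nonseparating:
  assumes "F \<subseteq> E" "\<And>F'. F' \<subseteq> F \<Longrightarrow> leaf_free F' \<Longrightarrow> F' = {}"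
  shows "connected (- drawing F)"
  using finite_subset[OF assms(1) finite_E] assms
proof (induction F rule: finite_psubset_induct)
  case (psubset F)
  show ?case
  proof (cases "F = {}")
    case True
    then have "drawing F = pos ` V"
      by (simp add: drawing_def)
    moreover have "connected (- (pos ` V))"
      unfolding Compl_eq_Diff_UNIV using finite_V connected_UNIV
      by (intro connected_open_delete_finite) auto
    ultimately show ?thesis by simp
  next
    case False
    then have "\<not> leaf_free F"
      using psubset.prems by blast
    then obtain e v where ev: "e \<in> F" "v \<in> e" "\<And>f. f \<in> F \<Longrightarrow> v \<in> f \<Longrightarrow> f = e"
      unfolding leaf_free_def by blast
    define A where "A = pos ` (V - {v}) \<inter> pos ` V \<union> (\<Union>f\<in>F - {e}. path_image (\<gamma> f))"
    have e: "e \<in> E" "F - {e} \<subseteq> E" "e \<notin> F - {e}"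
      using ev(1) psubset.prems(1) by auto
    have vV: "v \<in> V"
      using e(1) ev(2) edge_subset by blast
    have d: "drawing (F - {e}) = A \<union> {pos v}"
      using vV by (auto simp: drawing_def A_def)
    have vA: "pos v \<notin> A"
    proof
      assume "pos v \<in> A"
      then consider "pos v \<in> pos ` (V - {v})" | f where "f \<in> F - {e}" "pos v \<in> path_image (\<gamma> f)"
        unfolding A_def by blast
      then show False
      proof cases
        case 1
        then show False using inj_pos vV by (auto simp: inj_on_def)
      next
        case 2
        then show False using vertex_on_edge[of f v] vV ev(3) e by auto
      qed
    qed
    obtain u where u: "e = {u, v}" "u \<noteq> v" "u \<in> V"
      using edge[OF e(1)] ev(2) by (metis doubleton_eq_iff insert_iff singletonD)
    have ends: "path_image (\<gamma> e) \<inter> (A \<union> {pos v}) = {pos u, pos v}"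
      using edge_Int_drawing[OF e] edge_ends[OF e(1)] d u by simp
    have puv: "pos u \<noteq> pos v"
      using inj_pos u vV by (auto simp: inj_on_def)
    have uA: "path_image (\<gamma> e) \<inter> A = {pos u}" "path_image (\<gamma> e) \<inter> {pos v} = {pos v}"
      using ends vA puv by blast+
    have con: "connected (- drawing (F - {e}))"
      using ev(1) psubset.prems by (intro psubset.IH) auto
    have "connected_component (- drawing F) x y" if "x \<notin> drawing F" "y \<notin> drawing F" for x y
    proof -
      have dF: "drawing F = A \<union> {pos v} \<union> path_image (\<gamma> e)"
        using d drawing_insert[of e "F - {e}"] ev(1) by (simp add: insert_absorb)
      have "connected_component (- (A \<union> {pos v})) x y"
        using con that dF unfolding d connected_component_def by blast
      then show ?thesis
        unfolding dF using that uA vA e arc_edge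
        by (intro arc_add_bridge[of A "{pos v}" _ "pos u" "pos v"])
           (auto simp: dF A_def intro!: compact_arcs)
    qed
    then show ?thesis
      by (auto simp: connected_iff_connected_component)
  qed
qed

text \<open>The non-loop edges of the dual graph at the face containing \<open>a\<close>.\<close>
definition face_edges :: "complex \<Rightarrow> 'a set set" where
  "face_edges a = {e \<in> E. \<exists>b. b \<notin> drawing E \<and> \<not> connected_component (- drawing E) a b
     \<and> connected_component (- drawing (E - {e})) a b}"

lemma drawing_remove: "e \<in> F \<Longrightarrow> drawing (F - {e}) \<union> path_image (\<gamma> e) = drawing F"
  using drawing_insert[of e "F - {e}"] by (simp add: insert_absorb)

text \<open>The rest of the drawing falls into one compact piece at each end of \<open>e\<close>,
  and an arc between two such pieces separates nothing. By contraposition, the ends of a face edge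
  are joined in the rest of the drawing, which is what closes the edge to a Jordan curve.\<close>

lemma bridge_not_face_edge:
  assumes "e \<in> E" "\<not> path_component (drawing (E - {e})) (pathfinish (\<gamma> e)) (pathstart (\<gamma> e))"
    and ab: "connected_component (- drawing (E - {e})) a b" "a \<notin> drawing E" "b \<notin> drawing E"
  shows "connected_component (- drawing E) a b"
proof -
  let ?D = "drawing (E - {e})"
  \<comment> \<open>Each remaining edge is path connected, hence lies inside the path component
    \<open>S\<close> or avoids it. So \<open>A\<close> is the part of the rest inside
    \<open>S\<close> and \<open>B\<close> the part outside, and both are compact as finite unions of
    points and arcs.\<close>
  define S where "S = path_component_set ?D (pathfinish (\<gamma> e))"
  define V1 where "V1 = {v \<in> V. pos v \<in> S}"
  define A where "A = pos ` V1 \<inter> pos ` V \<union> (\<Union>f\<in>{f \<in> E - {e}. f \<inter> V1 \<noteq> {}}. path_image (\<gamma> f))"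
  define B where "B = pos ` (V - V1) \<inter> pos ` V \<union> (\<Union>f\<in>{f \<in> E - {e}. f \<inter> V1 = {}}. path_image (\<gamma> f))"
  have DAB: "?D = A \<union> B"
    unfolding drawing_def A_def B_def V1_def by auto
  have onS: "x \<in> S \<longleftrightarrow> pos v \<in> S" if "f \<in> E - {e}" "v \<in> f" "x \<in> path_image (\<gamma> f)" for f v x
  proof -
    have "path_component ?D x (pos v)"
      using that ends_in_image[of f] by (intro path_component_edge[of f]) auto
    then show ?thesis
      unfolding S_def mem_Collect_eq using path_component_trans path_component_sym by blast
  qed
  have AS: "A \<subseteq> S"
    using onS unfolding A_def V1_def by blast
  have BS: "B \<inter> S = {}"
  proof -
    have "x \<notin> S" if f: "f \<in> E - {e}" "f \<inter> V1 = {}" "x \<in> path_image (\<gamma> f)" for f x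
    proof -
      obtain v where "v \<in> f" "v \<in> V"
        using edge[of f] f(1) by blast
      then show ?thesis
        using onS[OF f(1) _ f(3), of v] f(2) by (auto simp: V1_def)
    qed
    moreover have "pos v \<notin> S" if "v \<in> V - V1" for v
      using that by (auto simp: V1_def)
    ultimately show ?thesis
      unfolding B_def by blast
  qed
  have int: "path_image (\<gamma> e) \<inter> ?D = {pathstart (\<gamma> e), pathfinish (\<gamma> e)}"
    using edge_Int_drawing[OF assms(1), of "E - {e}"] by auto
  then have SS: "pathfinish (\<gamma> e) \<in> S" "pathstart (\<gamma> e) \<notin> S"
    using assms(2) by (auto simp: S_def path_component_refl_eq)
  have iA: "path_image (\<gamma> e) \<inter> A = {pathfinish (\<gamma> e)}" "path_image (\<gamma> e) \<inter> B = {pathstart (\<gamma> e)}"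
  proof -
    have "A = ?D \<inter> S" "B = ?D - S"
      using DAB AS BS by blast+
    then have "path_image (\<gamma> e) \<inter> A = (path_image (\<gamma> e) \<inter> ?D) \<inter> S"
      "path_image (\<gamma> e) \<inter> B = (path_image (\<gamma> e) \<inter> ?D) - S"
      by blast+
    then show "path_image (\<gamma> e) \<inter> A = {pathfinish (\<gamma> e)}" "path_image (\<gamma> e) \<inter> B = {pathstart (\<gamma> e)}"
      using SS unfolding int by auto
  qed
  have "connected_component (- (A \<union> B \<union> path_image (\<gamma> e))) a b"
  proof (rule arc_add_bridge[OF _ _ arc_edge[OF assms(1)] _ iA])
    show "compact A" "compact B"
      unfolding A_def B_def by (intro compact_arcs; auto)+
    show "A \<inter> B = {}"
      using AS BS by blast
    show "connected_component (- (A \<union> B)) a b"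
      using ab(1) DAB by simp
    show "a \<notin> path_image (\<gamma> e)" "b \<notin> path_image (\<gamma> e)"
      using ab(2,3) assms(1) by (auto simp: drawing_def)
  qed
  then show ?thesis
    unfolding DAB[symmetric] drawing_remove[OF assms(1)] .
qed

text \<open>A face that has \<open>e\<close> among its face edges borders the open edge. Once
  \<open>e\<close> is deleted, all such faces lie in the one face containing the open edge, and
  restoring \<open>e\<close> splits that face into at most two parts.\<close>

lemma edge_on_two_faces:
  assumes "separated_by (drawing E) P" "finite P" "e \<in> E"
  shows "card {a \<in> P. e \<in> face_edges a} \<le> 2"
proof (rule ccontr)
  let ?A = "drawing (E - {e})" and ?g = "\<gamma> e"
  let ?Q = "{a \<in> P. e \<in> face_edges a}"
  assume "\<not> card ?Q \<le> 2"
  then have "3 \<le> card ?Q" by simp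
  then obtain T where "T \<subseteq> ?Q" "card T = 3"
    using obtain_subset_with_card_n by metis
  then obtain x y z where xyz: "{x, y, z} \<subseteq> ?Q" "x \<noteq> y" "x \<noteq> z" "y \<noteq> z"
    by (auto simp: card_3_iff)
  have int: "path_image ?g \<inter> ?A = {pathstart ?g, pathfinish ?g}"
    using edge_Int_drawing[OF assms(3), of "E - {e}"] by auto
  have cA: "compact ?A"
    by (intro compact_drawing) auto
  have nE: "a \<notin> drawing E" if "a \<in> ?Q" for a
    using that assms(1) by (auto simp: separated_by_def)
  have pc: "path_component ?A (pathfinish ?g) (pathstart ?g)"
    using bridge_not_face_edge[OF assms(3)] xyz(1) nE[of x] unfolding face_edges_def by blast
  have ng: "a \<notin> path_image ?g" if "a \<in> ?Q" for a
    using nE[OF that] assms(3) by (auto simp: drawing_def)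
  have near: "\<exists>w \<in> path_image ?g - ?A. connected_component (- ?A) a w" if a: "a \<in> ?Q" for a
  proof -
    obtain b where b: "\<not> connected_component (- drawing E) a b" "connected_component (- ?A) a b"
      using a unfolding face_edges_def by blast
    show ?thesis
    proof (rule component_frontier_meets_removed)
      show "\<not> connected_component (- (?A \<union> path_image ?g)) a b"
        using b(1) drawing_remove[OF assms(3)] by simp
    qed (use b ng[OF a] cA arc_edge[OF assms(3)] in \<open>auto simp: compact_imp_closed closed_arc_image\<close>)
  qed
  have conn: "connected_component (- ?A) a b" if ab: "a \<in> ?Q" "b \<in> ?Q" for a b
  proof -
    obtain w w' where w: "w \<in> path_image ?g - ?A" "connected_component (- ?A) a w"
      "w' \<in> path_image ?g - ?A" "connected_component (- ?A) b w'"
      using near[OF ab(1)] near[OF ab(2)] by blast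
    have "connected_component (- ?A) w w'"
      using arc_interior_connected[OF arc_edge[OF assms(3)] int w(1,3)] .
    then show ?thesis
      using w(2,4) connected_component_sym connected_component_trans by blast
  qed
  have "connected_component (- drawing E) x y \<or> connected_component (- drawing E) x z
      \<or> connected_component (- drawing E) y z"
    using arc_splits_at_most_two[OF cA arc_edge[OF assms(3)] int pc conn[of x y] conn[of x z]]
      ng[of x] ng[of y] ng[of z] xyz(1) unfolding drawing_remove[OF assms(3)] by blast
  then show False
    using assms(1) xyz unfolding separated_by_def by blast
qed

text \<open>Crossing a deleted edge outside \<open>face_edges a\<close> from the face of \<open>a\<close> leads back into that
  face.\<close>
lemma separated_by_face_edges:
  assumes "a \<notin> drawing E" "finite D" "D \<subseteq> E" "D \<inter> face_edges a = {}"
    and "b \<notin> drawing E" "\<not> connected_component (- drawing E) a b"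
  shows "\<not> connected_component (- drawing (E - D)) a b"
  using assms(2-)
proof (induction D arbitrary: b rule: finite_induct)
  case empty
  then show ?case by simp
next
  case (insert e D)
  let ?A = "drawing (E - insert e D)" and ?A' = "drawing (E - {e})" and ?X = "drawing (E - D)"
    and ?g = "\<gamma> e"
  have e: "e \<in> E" "e \<notin> face_edges a"
    using insert.prems by auto
  have IH: "\<not> connected_component (- ?X) a b'"
    if "b' \<notin> drawing E" "\<not> connected_component (- drawing E) a b'" for b'
    using insert.IH that insert.prems by auto
  have XA: "?X = ?A \<union> path_image ?g"
  proof -
    have "E - D = insert e (E - insert e D)"
      using insert by auto
    then show ?thesis by (simp add: drawing_insert)
  qed
  have clA: "closed ?A" "closed ?A'" "closed (path_image ?g)"
    using compact_drawing arc_edge[OF e(1)] by (auto intro!: compact_imp_closed closed_arc_image)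
  have sub: "- drawing E \<subseteq> - ?X" "- drawing E \<subseteq> - ?A'" "- ?A' \<subseteq> - ?A"
    using drawing_mono[of "E - D" E] drawing_mono[of "E - {e}" E] drawing_mono[of "E - insert e D" "E - {e}"]
    by auto
  have int: "path_image ?g \<inter> ?A' = {pathstart ?g, pathfinish ?g}"
    using edge_Int_drawing[OF e(1), of "E - {e}"] by auto
  have int': "path_image ?g \<inter> ?A = {pathstart ?g, pathfinish ?g}"
    using edge_Int_drawing[OF e(1), of "E - insert e D"] by auto
  \<comment> \<open>The point \<open>x'\<close> stays in the face of \<open>x\<close> relative to
    \<open>?X\<close> but lies next to a point \<open>w\<close> of the open edge, in a ball that
    avoids every other edge of \<open>E\<close>. This moves the situation from the drawing without
    \<open>insert e D\<close> to the drawing without \<open>e\<close> alone, to which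
    \<open>face_edges\<close> refers.\<close>
  have near: "\<exists>w x'. w \<in> path_image ?g - ?A' \<and> connected_component (- ?X) x x'
      \<and> connected_component (- ?A') w x' \<and> x' \<notin> drawing E"
    if xy: "connected_component (- ?A) x y" "\<not> connected_component (- ?X) x y" "x \<notin> drawing E" for x y
  proof -
    obtain w where w: "w \<in> path_image ?g - ?A" "w \<in> closure (connected_component_set (- ?X) x)"
    proof (rule component_frontier_meets_removed)
      show "\<not> connected_component (- (?A \<union> path_image ?g)) x y"
        using xy(2) XA by simp
      show "x \<notin> path_image ?g"
        using xy(3) e(1) by (auto simp: drawing_def)
    qed (use xy clA XA in auto)
    then have w': "w \<in> path_image ?g - ?A'"
      using int int' by blast
    then obtain r where r: "r > 0" "ball w r \<subseteq> - ?A'"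
      using clA(2) by (metis Compl_iff DiffD2 open_Compl open_contains_ball)
    then obtain x' where x': "x' \<in> connected_component_set (- ?X) x" "x' \<in> ball w r"
      using w(2) by (metis closure_approachable dist_commute mem_ball)
    then have "x' \<notin> ?X"
      using connected_component_in by fastforce
    then have "x' \<notin> drawing E"
      using x'(2) r(2) XA drawing_remove[OF e(1)] by auto
    moreover have "connected_component (- ?A') w x'"
      using r x'(2) by (auto simp: connected_component_def intro!: exI[of _ "ball w r"])
    ultimately show ?thesis
      using w' x' by auto
  qed
  show ?case
  proof
    assume ab: "connected_component (- ?A) a b"
    have nab: "\<not> connected_component (- ?X) a b"
      using IH insert.prems by auto
    obtain w a' where a': "w \<in> path_image ?g - ?A'" "connected_component (- ?X) a a'"
      "connected_component (- ?A') w a'" "a' \<notin> drawing E"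
      using near[OF ab nab assms(1)] by blast
    have "connected_component (- ?A) b a" "\<not> connected_component (- ?X) b a"
      using ab nab connected_component_sym by blast+
    then obtain w' b' where b': "w' \<in> path_image ?g - ?A'" "connected_component (- ?X) b b'"
      "connected_component (- ?A') w' b'" "b' \<notin> drawing E"
      using near insert.prems(3) by metis
    \<comment> \<open>By the induction hypothesis \<open>a'\<close> still lies in the face of
      \<open>a\<close>, whereas \<open>b'\<close> does not. Both are joined to the open edge when
      only \<open>e\<close> is deleted, which makes \<open>e\<close> a face edge of
      \<open>a\<close>.\<close>
    have "connected_component (- drawing E) a a'"
      using IH[of a'] a' by blast
    then have 1: "connected_component (- ?A') a a'"
      using connected_component_of_subset sub(2) by blast
    have "\<not> connected_component (- drawing E) a b'"
      using nab b'(2) connected_component_of_subset[OF _ sub(1)] connected_component_sym connected_component_trans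
      by blast
    moreover have "connected_component (- ?A') w w'"
      using arc_interior_connected[OF arc_edge[OF e(1)] int a'(1) b'(1)] .
    then have "connected_component (- ?A') a b'"
      using 1 a'(3) b'(3) connected_component_sym connected_component_trans by metis
    ultimately have "e \<in> face_edges a"
      using e(1) b'(4) unfolding face_edges_def by blast
    then show False
      using e(2) by simp
  qed
qed

theorem edge_bound:
  assumes "V \<noteq> {}" and girth: "\<And>F. F \<subseteq> E \<Longrightarrow> leaf_free F \<Longrightarrow> F \<noteq> {} \<Longrightarrow> 5 \<le> card F"
  shows "3 * card E < 5 * card V"
proof -
  obtain c P where P: "finite P" "separated_by (drawing E) P"
    "card E + card ((c :: 'a \<Rightarrow> 'a) ` V) + 1 \<le> card P + card V"
    using many_faces[of E] by blast
  have "card (c ` V) > 0"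
    using assms(1) finite_V by (simp add: card_gt_0_iff)
  then have lower: "card E + 2 \<le> card P + card V"
    using P(3) by linarith
  show ?thesis
  \<comment> \<open>Counting face edges needs a second face to be separated from. With at most one
    representative, \<open>lower\<close> already gives \<open>card E < card V\<close>.\<close>
  proof (cases "card P \<le> 1")
    case True
    then show ?thesis using lower by linarith
  next
    case False
    have "5 \<le> card (face_edges a)" if a: "a \<in> P" for a
    proof -
      have "P \<noteq> {a}"
        using False by auto
      then obtain b where b: "b \<in> P" "b \<noteq> a"
        using a by blast
      have ab: "a \<notin> drawing E" "b \<notin> drawing E" "\<not> connected_component (- drawing E) a b"
        using P(2) a b by (auto simp: separated_by_def disjoint_iff)
      have fe: "face_edges a \<subseteq> E"
        by (auto simp: face_edges_def)
      \<comment> \<open>Everything except the face edges of \<open>a\<close> is deleted at once.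
        What is left still separates the plane, so it contains a nonempty leaf-free edge
        set.\<close>
      have "\<not> connected_component (- drawing (E - (E - face_edges a))) a b"
        using ab finite_E by (intro separated_by_face_edges) auto
      then have "\<not> connected_component (- drawing (face_edges a)) a b"
        using fe by (simp add: double_diff)
      moreover have "a \<notin> drawing (face_edges a)" "b \<notin> drawing (face_edges a)"
        using ab drawing_mono[OF fe] by blast+
      ultimately have "\<not> connected (- drawing (face_edges a))"
        by (auto simp: connected_iff_connected_component)
      then obtain F where F: "F \<subseteq> face_edges a" "leaf_free F" "F \<noteq> {}"
        using forest_nonseparating[OF fe] by blast
      then have "5 \<le> card F"
        using girth fe by blast
      also have "\<dots> \<le> card (face_edges a)"
        using F(1) fe finite_E by (intro card_mono) (auto intro: finite_subset)
      finally show ?thesis .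
    qed
    then have "5 * card P \<le> (\<Sum>a\<in>P. card (face_edges a))"
      using sum_mono[of P "\<lambda>_. 5" "\<lambda>a. card (face_edges a)"] by simp
    also have "\<dots> = (\<Sum>a\<in>P. card {e \<in> E. e \<in> face_edges a})"
      by (intro sum.cong refl arg_cong[where f = card]) (auto simp: face_edges_def)
    also have "\<dots> = (\<Sum>e\<in>E. card {a \<in> P. e \<in> face_edges a})"
      using P(1) finite_E by (intro sum_multicount_gen[symmetric]) auto
    also have "\<dots> \<le> 2 * card E"
      using sum_mono[of E "\<lambda>e. card {a \<in> P. e \<in> face_edges a}" "\<lambda>_. 2"] edge_on_two_faces[OF P(2,1)] by simp
    finally show ?thesis
      using lower by linarith
  qed
qed

end

section \<open>Disjoint permutations of four elements\<close>

text \<open>Constructors and explicit lists turn the finite check below into an evaluation by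
  \<open>code_simp\<close>. The functions \<open>encode\<close> and \<open>decode\<close> transfer
  it to permutations.\<close>

datatype col = C1 | C2 | C3 | C4

fun disj_list :: "'a list \<Rightarrow> 'a list \<Rightarrow> bool" where
  "disj_list (x # xs) (y # ys) = (if x = y then False else disj_list xs ys)"
| "disj_list _ _ = True"

definition perms4 :: "col list list" where
  "perms4 = [[C1,C2,C3,C4], [C1,C2,C4,C3], [C1,C3,C2,C4], [C1,C3,C4,C2], [C1,C4,C2,C3], [C1,C4,C3,C2],
    [C2,C1,C3,C4], [C2,C1,C4,C3], [C2,C3,C1,C4], [C2,C3,C4,C1], [C2,C4,C1,C3], [C2,C4,C3,C1],
    [C3,C1,C2,C4], [C3,C1,C4,C2], [C3,C2,C1,C4], [C3,C2,C4,C1], [C3,C4,C1,C2], [C3,C4,C2,C1],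
    [C4,C1,C2,C3], [C4,C1,C3,C2], [C4,C2,C1,C3], [C4,C2,C3,C1], [C4,C3,C1,C2], [C4,C3,C2,C1]]"

definition derangements4 :: "col list list" where
  "derangements4 = [[C2,C1,C4,C3], [C2,C3,C4,C1], [C2,C4,C1,C3], [C3,C1,C4,C2], [C3,C4,C1,C2], [C3,C4,C2,C1],
    [C4,C1,C2,C3], [C4,C3,C1,C2], [C4,C3,C2,C1]]"

text \<open>Up to relabelling, \<open>m\<close> and \<open>n\<close> are what the two outer
  neighbours of an end vertex forbid, \<open>p\<close> is a candidate for the middle vertex, and the
  outer neighbour of the middle vertex forbids the identity. The count says that the end vertex
  blocks at most four of the nine candidates.\<close>

lemma derangements4_check:
  "list_all (\<lambda>m. let M = filter (disj_list m) perms4 in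
     list_all (\<lambda>n. let L = filter (disj_list n) M in
       5 \<le> length (filter (\<lambda>p. list_ex (disj_list p) L) derangements4)) perms4) perms4"
  by code_simp

lemma derangements4_eq: "derangements4 = filter (disj_list [C1,C2,C3,C4]) perms4"
  by (simp add: derangements4_def perms4_def)

lemma distinct_derangements4: "distinct derangements4"
  by (simp add: derangements4_def)

lemma in_perms4_iff: "l \<in> set perms4 \<longleftrightarrow> length l = 4 \<and> distinct l"
proof
  show "length l = 4 \<and> distinct l" if "l \<in> set perms4"
    using that by (auto simp: perms4_def)
  show "l \<in> set perms4" if l: "length l = 4 \<and> distinct l"
  proof -
    obtain a b c d where "l = [a, b, c, d]"
      using l by (auto simp: numeral_eq_Suc length_Suc_conv)
    then show ?thesis
      using l by (cases a; cases b; cases c; cases d) (simp_all add: perms4_def)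
  qed
qed

section \<open>Translation between colour lists and permutations of \<open>{1..4}\<close>\<close>

fun nat_of_col :: "col \<Rightarrow> nat" where
  "nat_of_col C1 = 1" | "nat_of_col C2 = 2" | "nat_of_col C3 = 3" | "nat_of_col C4 = 4"

definition col_of_nat :: "nat \<Rightarrow> col" where
  "col_of_nat i = (if i = 1 then C1 else if i = 2 then C2 else if i = 3 then C3 else C4)"

definition encode :: "(nat \<Rightarrow> nat) \<Rightarrow> col list" where
  "encode p = [col_of_nat (p 1), col_of_nat (p 2), col_of_nat (p 3), col_of_nat (p 4)]"

definition decode :: "col list \<Rightarrow> nat \<Rightarrow> nat" where
  "decode l i = (if i \<in> {1..4} then nat_of_col (l ! (i - 1)) else i)"

lemma atLeastAtMost_1_4: "{1..4} = {1, 2, 3, 4::nat}"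
  by auto

lemma ball_1_4: "(\<forall>i\<in>{1..4::nat}. Q i) \<longleftrightarrow> Q 1 \<and> Q 2 \<and> Q 3 \<and> Q 4"
  unfolding atLeastAtMost_1_4 by auto

lemma col_of_nat_of_col: "col_of_nat (nat_of_col c) = c"
  by (cases c) (auto simp: col_of_nat_def)

lemma nat_of_col_of_nat: "i \<in> {1..4} \<Longrightarrow> nat_of_col (col_of_nat i) = i"
  unfolding atLeastAtMost_1_4 by (auto simp: col_of_nat_def)

lemma col_of_nat_eq_iff: "i \<in> {1..4} \<Longrightarrow> j \<in> {1..4} \<Longrightarrow> col_of_nat i = col_of_nat j \<longleftrightarrow> i = j"
  using nat_of_col_of_nat by metis

lemma nat_of_col_range: "nat_of_col c \<in> {1..4}"
  by (cases c) auto

definition disj_fun :: "(nat \<Rightarrow> nat) \<Rightarrow> (nat \<Rightarrow> nat) \<Rightarrow> bool" where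
  "disj_fun p q \<longleftrightarrow> (\<forall>i\<in>{1..4}. p i \<noteq> q i)"

lemma disj_fun_sym: "disj_fun p q \<longleftrightarrow> disj_fun q p"
  by (auto simp: disj_fun_def)

lemma disj_list_encode:
  assumes "p permutes {1..4}" "q permutes {1..4}"
  shows "disj_list (encode p) (encode q) \<longleftrightarrow> disj_fun p q"
proof -
  have "p i \<in> {1..4}" "q i \<in> {1..4}" if "i \<in> {1..4}" for i
    using that assms permutes_in_image by metis+
  then have "col_of_nat (p i) = col_of_nat (q i) \<longleftrightarrow> p i = q i" if "i \<in> {1..4}" for i
    using that by (intro col_of_nat_eq_iff) auto
  then show ?thesis
    unfolding disj_fun_def ball_1_4 by (simp add: encode_def)
qed

lemma encode_in_perms4:
  assumes "p permutes {1..4}"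
  shows "encode p \<in> set perms4"
proof -
  have "p i \<in> {1..4}" if "i \<in> {1..4}" for i
    using that assms permutes_in_image by metis
  then have "col_of_nat (p i) = col_of_nat (p j) \<longleftrightarrow> p i = p j" if "i \<in> {1..4}" "j \<in> {1..4}" for i j
    using that by (intro col_of_nat_eq_iff) auto
  moreover have "p i = p j \<longleftrightarrow> i = j" for i j
    using permutes_inj[OF assms] by (auto simp: inj_def)
  ultimately show ?thesis
    unfolding in_perms4_iff by (auto simp: encode_def)
qed

lemma encode_decode:
  assumes "length l = 4"
  shows "encode (decode l) = l"
proof -
  obtain a b c d where "l = [a, b, c, d]"
    using assms by (auto simp: numeral_eq_Suc length_Suc_conv)
  then show ?thesis
    by (simp add: encode_def decode_def col_of_nat_of_col)
qed

lemma decode_permutes: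
  assumes "l \<in> set perms4"
  shows "decode l permutes {1..4}"
proof (rule bij_imp_permutes)
  have l: "length l = 4" "distinct l"
    using assms in_perms4_iff by auto
  have "inj_on (decode l) {1..4}"
  proof (rule inj_onI)
    fix i j :: nat assume ij: "i \<in> {1..4}" "j \<in> {1..4}" "decode l i = decode l j"
    then have "l ! (i - 1) = l ! (j - 1)"
      using col_of_nat_of_col by (metis decode_def)
    then have "i - 1 = j - 1"
      using ij(1,2) l by (subst (asm) nth_eq_iff_index_eq) auto
    then show "i = j"
      using ij by auto
  qed
  moreover have "decode l ` {1..4} \<subseteq> {1..4}"
    using nat_of_col_range by (auto simp: decode_def)
  ultimately show "bij_betw (decode l) {1..4} {1..4}"
    by (simp add: bij_betw_def endo_inj_surj)
  show "decode l i = i" if "i \<notin> {1..4}" for i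
    using that by (auto simp: decode_def)
qed

lemma encode_inj:
  assumes "p permutes {1..4}" "q permutes {1..4}" "encode p = encode q"
  shows "p = q"
proof -
  have pq: "p i \<in> {1..4}" "q i \<in> {1..4}" if "i \<in> {1..4}" for i
    using that assms permutes_in_image by metis+
  have "\<forall>i\<in>{1..4}. col_of_nat (p i) = col_of_nat (q i)"
    unfolding ball_1_4 using assms(3) by (simp add: encode_def)
  then have "p i = q i" if "i \<in> {1..4}" for i
    using that pq col_of_nat_eq_iff by metis
  then show ?thesis
    using assms(1,2) by (metis ext permutes_not_in)
qed

lemma disj_fun_comp:
  assumes "s permutes {1..4}"
  shows "disj_fun (s \<circ> p) (s \<circ> q) \<longleftrightarrow> disj_fun p q"
  using permutes_inj[OF assms] by (auto simp: disj_fun_def inj_def)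

definition avoiding :: "(nat \<Rightarrow> nat) \<Rightarrow> (nat \<Rightarrow> nat) set" where
  "avoiding t = {g. g permutes {1..4} \<and> disj_fun g t}"

lemma finite_avoiding: "finite (avoiding t)"
  by (rule finite_subset[OF _ finite_permutations[of "{1..4::nat}"]]) (auto simp: avoiding_def)

lemma comp_inv_cancel:
  assumes "t permutes S"
  shows "t \<circ> (inv t \<circ> g) = g" "inv t \<circ> (t \<circ> g) = g"
  using permutes_inv_o[OF assms] by (metis comp_assoc id_comp)+

text \<open>Composing with \<open>inv t\<close> on the left turns the permutations disjoint from
  \<open>t\<close> into derangements, of which there are nine.\<close>

lemma card_avoiding:
  assumes t: "t permutes {1..4}"
  shows "card (avoiding t) \<le> 9"
proof -
  let ?f = "\<lambda>g. encode (inv t \<circ> g)"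
  have t': "inv t permutes {1..4}"
    using t by (rule permutes_inv)
  have "?f ` avoiding t \<subseteq> set derangements4"
  proof
    fix l assume "l \<in> ?f ` avoiding t"
    then obtain g where g: "g permutes {1..4}" "disj_fun g t" "l = ?f g"
      by (auto simp: avoiding_def)
    have "inv t \<circ> g permutes {1..4}"
      using g(1) t' by (rule permutes_compose)
    moreover have "disj_fun id (inv t \<circ> g)"
      using g(2) disj_fun_comp[OF t', of t g] permutes_inv_o(2)[OF t] disj_fun_sym by metis
    moreover have "encode id = [C1,C2,C3,C4]"
      by (simp add: encode_def col_of_nat_def)
    ultimately show "l \<in> set derangements4"
      using g(3) encode_in_perms4 disj_list_encode[OF permutes_id] unfolding derangements4_eq
      by (metis (no_types, lifting) mem_Collect_eq set_filter)
  qed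
  moreover have "inj_on ?f (avoiding t)"
  proof (rule inj_onI)
    fix g h assume gh: "g \<in> avoiding t" "h \<in> avoiding t" "?f g = ?f h"
    then have "inv t \<circ> g = inv t \<circ> h"
      using t' by (intro encode_inj) (auto simp: avoiding_def intro: permutes_compose)
    then show "g = h"
      using comp_inv_cancel[OF t] by metis
  qed
  ultimately have "card (avoiding t) \<le> card (set derangements4)"
    by (intro card_inj_on_le) auto
  also have "\<dots> \<le> 9"
    by (simp add: derangements4_def card_insert_if)
  finally show ?thesis .
qed

text \<open>Disjointness is invariant under composition on the left, so \<open>inv t\<close>
  normalises \<open>t\<close> to the identity, the case settled by evaluation.\<close>

lemma card_extendable:
  assumes "m permutes {1..4}" "n permutes {1..4}" and t: "t permutes {1..4}"
  shows "5 \<le> card {g \<in> avoiding t. avoiding m \<inter> avoiding n \<inter> avoiding g \<noteq> {}}" (is "_ \<le> card ?X")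
proof -
  have t': "inv t permutes {1..4}"
    using t by (rule permutes_inv)
  define m' n' where "m' = inv t \<circ> m" and "n' = inv t \<circ> n"
  have mn: "m' permutes {1..4}" "n' permutes {1..4}"
    using assms t' by (auto simp: m'_def n'_def intro: permutes_compose)
  define L where "L = filter (disj_list (encode n')) (filter (disj_list (encode m')) perms4)"
  define G where "G = filter (\<lambda>p. list_ex (disj_list p) L) derangements4"
  have "5 \<le> length G"
    using derangements4_check encode_in_perms4[OF mn(1)] encode_in_perms4[OF mn(2)]
    unfolding G_def L_def Let_def list_all_iff by blast
  then have "5 \<le> card (set G)"
    using distinct_card[of G] distinct_filter[OF distinct_derangements4] unfolding G_def by metis
  also have "\<dots> \<le> card ?X"
  proof (rule card_inj_on_le)
    let ?f = "\<lambda>l. t \<circ> decode l"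
    have G: "l \<in> set perms4" "disj_list [C1,C2,C3,C4] l" if "l \<in> set G" for l
      using that by (auto simp: G_def derangements4_eq)
    show "inj_on ?f (set G)"
    proof (rule inj_onI)
      fix k l assume kl: "k \<in> set G" "l \<in> set G" "?f k = ?f l"
      then have "decode k = decode l"
        using comp_inv_cancel(2)[OF t] by metis
      then show "k = l"
        using encode_decode G in_perms4_iff kl by metis
    qed
    show "?f ` set G \<subseteq> ?X"
    proof
      fix g assume "g \<in> ?f ` set G"
      then obtain l where l: "l \<in> set G" "g = t \<circ> decode l" by auto
      have l4: "l \<in> set perms4" "disj_list [C1,C2,C3,C4] l"
        using G l by auto
      have dl: "decode l permutes {1..4}" "encode (decode l) = l"
        using decode_permutes[OF l4(1)] encode_decode l4(1) in_perms4_iff by auto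
      have "encode id = [C1,C2,C3,C4]"
        by (simp add: encode_def col_of_nat_def)
      then have "disj_fun id (decode l)"
        using disj_list_encode[OF permutes_id dl(1)] dl(2) l4(2) by simp
      then have "disj_fun g t"
        using disj_fun_comp[OF t, of id "decode l"] disj_fun_sym l(2) by (metis comp_id)
      moreover have gp: "g permutes {1..4}"
        unfolding l(2) using dl(1) t by (rule permutes_compose)
      ultimately have g: "g \<in> avoiding t"
        by (simp add: avoiding_def)
      obtain r where r: "r \<in> set perms4" "disj_list (encode m') r" "disj_list (encode n') r" "disj_list l r"
        using l(1) by (auto simp: G_def L_def list_ex_iff)
      have dr: "decode r permutes {1..4}" "encode (decode r) = r"
        using decode_permutes[OF r(1)] encode_decode r(1) in_perms4_iff by auto
      have "disj_fun m' (decode r)" "disj_fun n' (decode r)" "disj_fun (decode l) (decode r)"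
        using disj_list_encode[OF mn(1) dr(1)] disj_list_encode[OF mn(2) dr(1)]
          disj_list_encode[OF dl(1) dr(1)] r dr(2) dl(2) by auto
      then have "disj_fun (t \<circ> m') (t \<circ> decode r)" "disj_fun (t \<circ> n') (t \<circ> decode r)"
        "disj_fun g (t \<circ> decode r)"
        using disj_fun_comp[OF t] l(2) by auto
      moreover have "t \<circ> m' = m" "t \<circ> n' = n"
        using comp_inv_cancel[OF t] by (auto simp: m'_def n'_def)
      moreover have "t \<circ> decode r permutes {1..4}"
        using dr(1) t by (rule permutes_compose)
      ultimately have "t \<circ> decode r \<in> avoiding m \<inter> avoiding n \<inter> avoiding g"
        using disj_fun_sym by (auto simp: avoiding_def)
      with g show "g \<in> ?X" by blast
    qed
    show "finite ?X"
      using finite_avoiding by (rule finite_subset[rotated]) auto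
  qed
  finally show ?thesis .
qed

text \<open>A value disjoint from \<open>m\<close>, \<open>n\<close> and some further
  \<open>g\<close> exists by \<open>card_extendable\<close>. The choice of \<open>id\<close> for
  \<open>t\<close> is arbitrary.\<close>

lemma avoid_two:
  assumes "m permutes {1..4}" "n permutes {1..4}"
  obtains r where "r \<in> avoiding m" "r \<in> avoiding n"
proof -
  have "card {g \<in> avoiding id. avoiding m \<inter> avoiding n \<inter> avoiding g \<noteq> {}} \<noteq> 0"
    using card_extendable[OF assms permutes_id] by linarith
  then have "{g \<in> avoiding id. avoiding m \<inter> avoiding n \<inter> avoiding g \<noteq> {}} \<noteq> {}"
    by (metis (no_types, lifting) card.empty)
  then show ?thesis
    using that by auto
qed

text \<open>Of the at most nine candidates \<open>b\<close>, at least five extend to \<open>a\<close> and at least five to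
  \<open>c\<close>; some \<open>b\<close> does both.\<close>
lemma avoid_path:
  assumes "m permutes {1..4}" "m' permutes {1..4}" "n permutes {1..4}" "n' permutes {1..4}"
    and t: "t permutes {1..4}" and ab: "\<alpha> permutes {1..4}" "\<beta> permutes {1..4}"
  obtains a b c where "b \<in> avoiding t"
    "a \<in> avoiding m" "a \<in> avoiding m'" "a \<in> avoiding (\<alpha> \<circ> b)"
    "c \<in> avoiding n" "c \<in> avoiding n'" "c \<in> avoiding (\<beta> \<circ> b)"
proof -
  define X where "X \<alpha> m m' = {b \<in> avoiding t. avoiding m \<inter> avoiding m' \<inter> avoiding (\<alpha> \<circ> b) \<noteq> {}}"
    for \<alpha> m m'
  have card_X: "5 \<le> card (X \<alpha> m m')"
    if "\<alpha> permutes {1..4}" "m permutes {1..4}" "m' permutes {1..4}" for \<alpha> m m'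
  proof -
    \<comment> \<open>Seen from the end vertex, the middle value is
      \<open>\<alpha> \<circ> b\<close>, and it avoids \<open>\<alpha> \<circ> t\<close> exactly
      when \<open>b\<close> avoids \<open>t\<close>. The bound is applied on that side and pulled
      back by \<open>inv \<alpha>\<close>.\<close>
    let ?Y = "{g \<in> avoiding (\<alpha> \<circ> t). avoiding m \<inter> avoiding m' \<inter> avoiding g \<noteq> {}}"
    have \<alpha>': "inv \<alpha> permutes {1..4}"
      using that(1) by (rule permutes_inv)
    have "5 \<le> card ?Y"
      using that t by (intro card_extendable) (auto intro: permutes_compose)
    also have "\<dots> \<le> card (X \<alpha> m m')"
    proof (rule card_inj_on_le)
      show "inj_on (\<lambda>g. inv \<alpha> \<circ> g) ?Y"
        using comp_inv_cancel[OF that(1)] by (metis (no_types, lifting) inj_onI)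
      show "(\<lambda>g. inv \<alpha> \<circ> g) ` ?Y \<subseteq> X \<alpha> m m'"
      proof
        fix b assume "b \<in> (\<lambda>g. inv \<alpha> \<circ> g) ` ?Y"
        then obtain g where g: "g \<in> ?Y" "b = inv \<alpha> \<circ> g" by auto
        have "g = \<alpha> \<circ> b"
          using g(2) comp_inv_cancel[OF that(1)] by metis
        moreover have "b permutes {1..4}"
          unfolding g(2) using g(1) \<alpha>' by (auto simp: avoiding_def intro: permutes_compose)
        ultimately show "b \<in> X \<alpha> m m'"
          using g(1) disj_fun_comp[OF that(1)] by (auto simp: X_def avoiding_def)
      qed
      show "finite (X \<alpha> m m')"
        unfolding X_def using finite_avoiding by (rule finite_subset[rotated]) auto
    qed
    finally show ?thesis .
  qed
  have "X \<alpha> m m' \<inter> X \<beta> n n' \<noteq> {}"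
  proof
    assume disj: "X \<alpha> m m' \<inter> X \<beta> n n' = {}"
    have sub: "X \<alpha> m m' \<union> X \<beta> n n' \<subseteq> avoiding t"
      by (auto simp: X_def)
    have "card (X \<alpha> m m') + card (X \<beta> n n') = card (X \<alpha> m m' \<union> X \<beta> n n')"
      using disj sub finite_avoiding by (intro card_Un_disjoint[symmetric]) (auto intro: finite_subset)
    also have "\<dots> \<le> card (avoiding t)"
      using sub finite_avoiding by (rule card_mono[rotated])
    also have "\<dots> \<le> 9"
      using t by (rule card_avoiding)
    finally show False
      using card_X[OF ab(1) assms(1,2)] card_X[OF ab(2) assms(3,4)] by linarith
  qed
  then show ?thesis
    using that unfolding X_def by blast
qed

section \<open>Reducible and unavoidable configurations\<close>

lemma subset_doubletonI:
  assumes "card N \<le> 2" "finite N"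
  obtains x y where "N \<subseteq> {x, y}"
proof -
  consider "card N = 0" | "card N = 1" | "card N = 2"
    using assms(1) by linarith
  then show ?thesis
  proof cases
    case 1
    then show ?thesis using assms(2) that by auto
  next
    case 2
    then show ?thesis using that by (metis card_1_singletonE insertI1 subset_insertI2 subset_refl)
  next
    case 3
    then show ?thesis using that by (metis card_2_iff subset_refl)
  qed
qed

section \<open>Degrees and discharging\<close>

definition degree_in :: "('a \<times> 'a) set \<Rightarrow> 'a set \<Rightarrow> 'a \<Rightarrow> nat" where
  "degree_in E W v = card {w \<in> W. (v, w) \<in> E}"

definition edges_in :: "('a \<times> 'a) set \<Rightarrow> 'a set \<Rightarrow> 'a set set" where
  "edges_in E W = {{u, v} | u v. (u, v) \<in> E \<and> u \<in> W \<and> v \<in> W}"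

lemma ordered_pairs_of_doubleton: "{(u, v). {u, v} = {x, y}} = {(x, y), (y, x)}"
  by (auto simp: doubleton_eq_iff)

text \<open>The degrees count ordered pairs, and at most two ordered pairs have the same underlying
  edge.\<close>

lemma sum_degree_le:
  assumes "finite W"
  shows "(\<Sum>v\<in>W. degree_in E W v) \<le> 2 * card (edges_in E W)"
proof -
  have fin: "finite (edges_in E W)"
    by (rule finite_subset[of _ "Pow W"]) (use assms in \<open>auto simp: edges_in_def\<close>)
  have "(\<Sum>v\<in>W. degree_in E W v) = card (SIGMA v:W. {w \<in> W. (v, w) \<in> E})"
    unfolding degree_in_def using assms by (intro card_SigmaI[symmetric]) auto
  also have "\<dots> \<le> card (\<Union>e\<in>edges_in E W. {(u, v). {u, v} = e})"
  proof (rule card_mono)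
    have "finite {(u, v). {u, v} = e}" if e: "e \<in> edges_in E W" for e
    proof -
      obtain x y where "e = {x, y}"
        using e by (auto simp: edges_in_def)
      then show ?thesis
        by (simp add: ordered_pairs_of_doubleton)
    qed
    then show "finite (\<Union>e\<in>edges_in E W. {(u, v). {u, v} = e})"
      using fin by blast
    show "(SIGMA v:W. {w \<in> W. (v, w) \<in> E}) \<subseteq> (\<Union>e\<in>edges_in E W. {(u, v). {u, v} = e})"
      by (auto simp: edges_in_def)
  qed
  also have "\<dots> \<le> (\<Sum>e\<in>edges_in E W. card {(u, v). {u, v} = e})"
    using fin by (rule card_UN_le)
  also have "\<dots> \<le> (\<Sum>e\<in>edges_in E W. 2)"
  proof (rule sum_mono)
    fix e assume "e \<in> edges_in E W"
    then obtain x y where e: "e = {x, y}"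
      by (auto simp: edges_in_def)
    have "card (set [(x, y), (y, x)]) \<le> length [(x, y), (y, x)]"
      by (rule card_length)
    then show "card {(u, v). {u, v} = e} \<le> 2"
      unfolding e ordered_pairs_of_doubleton by (simp only: list.set list.size One_nat_def[symmetric] add_0 one_add_one)
  qed
  finally show ?thesis by simp
qed

text \<open>Discharging: the initial charges \<open>3 d(v) - 10\<close> have negative sum. A vertex of degree
  \<open>d \<ge> 4\<close> has charge at least \<open>d / 2\<close> and can give \<open>1 / 2\<close> to every neighbour, so some
  3-vertex, of charge \<open>- 1\<close>, has fewer than two neighbours of degree at least four.\<close>
lemma unavoidable_configuration:
  assumes "finite W" "sym E" "3 * card (edges_in E W) < 5 * card W"
    and min_deg: "\<And>v. v \<in> W \<Longrightarrow> 3 \<le> degree_in E W v"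
  obtains u v w where "u \<in> W" "v \<in> W" "w \<in> W" "u \<noteq> w" "(v, u) \<in> E" "(v, w) \<in> E"
    "degree_in E W u = 3" "degree_in E W v = 3" "degree_in E W w = 3"
proof (rule ccontr)
  note uvw = that
  assume no: "\<not> thesis"
  define T where "T = {v \<in> W. degree_in E W v = 3}"
  define F where "F = W - T"
  have fin: "finite T" "finite F" "T \<inter> F = {}" "T \<union> F = W"
    using assms(1) by (auto simp: T_def F_def)
  \<comment> \<open>Two neighbours of \<open>t\<close> within \<open>T\<close> would form the
    excluded configuration, so at most one of its three neighbours lies in \<open>T\<close>.\<close>
  have two: "2 \<le> card {w \<in> F. (t, w) \<in> E}" if t: "t \<in> T" for t
  proof -
    have "u = w" if "u \<in> T" "(t, u) \<in> E" "w \<in> T" "(t, w) \<in> E" for u w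
      using that t no uvw by (auto simp: T_def)
    then have "card {w \<in> T. (t, w) \<in> E} \<le> 1"
      using fin(1) by (simp add: card_le_Suc0_iff_eq)
    moreover have "{w \<in> W. (t, w) \<in> E} = {w \<in> T. (t, w) \<in> E} \<union> {w \<in> F. (t, w) \<in> E}"
      using fin(4) by auto
    then have "card {w \<in> W. (t, w) \<in> E} \<le> card {w \<in> T. (t, w) \<in> E} + card {w \<in> F. (t, w) \<in> E}"
      by (simp only: card_Un_le)
    moreover have "card {w \<in> W. (t, w) \<in> E} = 3"
      using t by (simp add: T_def degree_in_def)
    ultimately show ?thesis by linarith
  qed
  let ?S = "\<Sum>x\<in>F. degree_in E W x"
  have "2 * card T \<le> (\<Sum>t\<in>T. card {w \<in> F. (t, w) \<in> E})"
    using sum_mono[of T "\<lambda>_. 2" "\<lambda>t. card {w \<in> F. (t, w) \<in> E}"] two by (simp add: mult.commute)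
  also have "\<dots> = (\<Sum>x\<in>F. card {t \<in> T. (t, x) \<in> E})"
    using fin by (intro sum_multicount_gen) auto
  also have "\<dots> \<le> ?S"
  proof (rule sum_mono)
    fix x assume "x \<in> F"
    show "card {t \<in> T. (t, x) \<in> E} \<le> degree_in E W x"
      unfolding degree_in_def using assms(1,2) fin by (intro card_mono) (auto dest: symD)
  qed
  finally have 1: "2 * card T \<le> ?S" .
  have "4 \<le> degree_in E W x" if "x \<in> F" for x
    using that min_deg[of x] by (auto simp: F_def T_def)
  then have 2: "4 * card F \<le> ?S"
    using sum_mono[of F "\<lambda>_. 4" "degree_in E W"] by (simp add: mult.commute)
  have "(\<Sum>v\<in>W. degree_in E W v) = (\<Sum>v\<in>T. degree_in E W v) + ?S"
    using fin by (metis sum.union_disjoint)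
  also have "(\<Sum>v\<in>T. degree_in E W v) = 3 * card T"
    by (simp add: T_def)
  finally have "3 * card T + ?S \<le> 2 * card (edges_in E W)"
    using sum_degree_le[OF assms(1), of E] by linarith
  moreover have "card W = card T + card F"
    using fin by (metis card_Un_disjoint)
  \<comment> \<open>Half of bound 1 plus five halves of bound 2 give
    \<open>3 * ?S >= card T + 10 * card F\<close>. Six times the number of edges is therefore at
    least \<open>9 * card T + 3 * ?S\<close>, hence at least \<open>10 * card W\<close>.\<close>
  ultimately show False
    using assms(3) 1 2 by linarith
qed


section \<open>Extending packings over the reducible configurations\<close>

locale correspondence =
  fixes V :: "'a set" and E :: "('a \<times> 'a) set" and \<tau> :: "'a \<times> 'a \<Rightarrow> nat \<Rightarrow> nat"
  assumes finite_V: "finite V"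
    and sym_E: "sym E"
    and loopfree: "(v, v) \<notin> E"
    and perm: "a \<in> E \<Longrightarrow> \<tau> a permutes {1..4}"
    and inverse: "(v, w) \<in> E \<Longrightarrow> \<tau> (w, v) = inv (\<tau> (v, w))"
begin

definition packing :: "'a set \<Rightarrow> ('a \<Rightarrow> nat \<Rightarrow> nat) \<Rightarrow> bool" where
  "packing W f \<longleftrightarrow> (\<forall>v\<in>W. f v permutes {1..4}) \<and>
     (\<forall>v\<in>W. \<forall>w\<in>W. (v, w) \<in> E \<longrightarrow> disj_fun (f w) (\<tau> (v, w) \<circ> f v))"

lemma disj_fun_edge_sym:
  assumes "(v, w) \<in> E"
  shows "disj_fun q (\<tau> (v, w) \<circ> p) \<longleftrightarrow> disj_fun p (\<tau> (w, v) \<circ> q)"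
proof -
  have "(w, v) \<in> E"
    using assms sym_E by (auto dest: symD)
  then have "disj_fun q (\<tau> (v, w) \<circ> p) \<longleftrightarrow> disj_fun (\<tau> (w, v) \<circ> q) (\<tau> (w, v) \<circ> (\<tau> (v, w) \<circ> p))"
    using disj_fun_comp[OF perm] by blast
  also have "\<tau> (w, v) \<circ> (\<tau> (v, w) \<circ> p) = p"
    unfolding inverse[OF assms] using comp_inv_cancel[OF perm[OF assms]] by blast
  finally show ?thesis
    using disj_fun_sym by blast
qed

lemma packing_insert:
  assumes "packing W f" "v \<notin> W" "q permutes {1..4}"
    and "\<And>x. x \<in> W \<Longrightarrow> (x, v) \<in> E \<Longrightarrow> disj_fun q (\<tau> (x, v) \<circ> f x)"
  shows "packing (insert v W) (f(v := q))"
  unfolding packing_def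
proof (intro conjI ballI impI)
  show "(f(v := q)) x permutes {1..4}" if "x \<in> insert v W" for x
    using that assms by (auto simp: packing_def)
  show "disj_fun ((f(v := q)) y) (\<tau> (x, y) \<circ> (f(v := q)) x)"
    if xy: "x \<in> insert v W" "y \<in> insert v W" "(x, y) \<in> E" for x y
  proof -
    consider "x = v" "y \<in> W" | "y = v" "x \<in> W" | "x \<in> W" "y \<in> W"
      using xy loopfree by blast
    then show ?thesis
    proof cases
      case 1
      then have "disj_fun q (\<tau> (y, v) \<circ> f y)"
        using xy(3) sym_E by (intro assms(4)) (auto dest: symD)
      then have "disj_fun (f y) (\<tau> (v, y) \<circ> q)"
        using disj_fun_edge_sym[of v y] xy(3) 1(1) by blast
      then show ?thesis
        using 1 assms(2) by auto
    next
      case 2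
      then show ?thesis using assms(2) assms(4)[of x] xy(3) by auto
    next
      case 3
      then show ?thesis using assms(1,2) xy(3) by (auto simp: packing_def)
    qed
  qed
qed

text \<open>The value \<open>id\<close> is padding: it stands in when \<open>x\<close> is not a
  neighbour of \<open>v\<close> in \<open>W\<close> and only adds a restriction. Lemmas with a fixed
  number of forbidden permutations thus also serve vertices with fewer neighbours.\<close>

definition forbidden :: "'a set \<Rightarrow> ('a \<Rightarrow> nat \<Rightarrow> nat) \<Rightarrow> 'a \<Rightarrow> 'a \<Rightarrow> nat \<Rightarrow> nat" where
  "forbidden W f v x = (if x \<in> W \<and> (x, v) \<in> E then \<tau> (x, v) \<circ> f x else id)"

lemma forbidden_permutes: "packing W f \<Longrightarrow> forbidden W f v x permutes {1..4}"
  using permutes_compose[OF _ perm] by (simp add: forbidden_def packing_def)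

lemma extend_vertex:
  assumes "finite W" "v \<in> W" "degree_in E W v \<le> 2" "packing (W - {v}) f"
  shows "\<exists>g. packing W g"
proof -
  have "finite {w \<in> W. (v, w) \<in> E}" "card {w \<in> W. (v, w) \<in> E} \<le> 2"
    using assms(1,3) by (auto simp: degree_in_def)
  then obtain x y where xy: "{w \<in> W. (v, w) \<in> E} \<subseteq> {x, y}"
    using subset_doubletonI by metis
  let ?m = "forbidden (W - {v}) f v"
  obtain r where r: "r \<in> avoiding (?m x)" "r \<in> avoiding (?m y)"
    using avoid_two forbidden_permutes[OF assms(4)] by metis
  have "packing (insert v (W - {v})) (f(v := r))"
  proof (rule packing_insert[OF assms(4)])
    show "r permutes {1..4}"
      using r by (simp add: avoiding_def)
    fix z assume z: "z \<in> W - {v}" "(z, v) \<in> E"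
    then have "z = x \<or> z = y"
      using xy sym_E by (auto dest: symD)
    then show "disj_fun r (\<tau> (z, v) \<circ> f z)"
      using r z by (auto simp: avoiding_def forbidden_def)
  qed simp
  then show ?thesis
    using assms(2) by (auto simp: insert_absorb)
qed

text \<open>Besides \<open>v\<close>, each end has two neighbours, which are the two outer
  constraints in \<open>avoid_path\<close>; \<open>v\<close> contributes the third. Since
  \<open>u\<close> and \<open>w\<close> are not adjacent, their values can be chosen independently
  once \<open>v\<close> has its value.\<close>

lemma extend_path:
  assumes "finite W" "u \<in> W" "v \<in> W" "w \<in> W" "u \<noteq> w" "(v, u) \<in> E" "(v, w) \<in> E" "(u, w) \<notin> E"
    and deg: "degree_in E W u = 3" "degree_in E W v = 3" "degree_in E W w = 3"
    and f: "packing (W - {u, v, w}) f"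
  shows "\<exists>g. packing W g"
proof -
  let ?W = "W - {u, v, w}"
  have ne: "u \<noteq> v" "w \<noteq> v"
    using assms loopfree by auto
  have nb: "(u, v) \<in> E" "(w, v) \<in> E" "(w, u) \<notin> E"
    using assms sym_E by (auto dest: symD)
  have ends: "\<exists>x y. {z \<in> W. (s, z) \<in> E} - {v} \<subseteq> {x, y}" if "degree_in E W s = 3" "(s, v) \<in> E" for s
  proof -
    have "card ({z \<in> W. (s, z) \<in> E} - {v}) = 2"
      using that assms(1,3) by (subst card_Diff_singleton) (auto simp: degree_in_def)
    then show ?thesis
      using subset_doubletonI[of "{z \<in> W. (s, z) \<in> E} - {v}"] assms(1) by fastforce
  qed
  obtain x x' where x: "{z \<in> W. (u, z) \<in> E} - {v} \<subseteq> {x, x'}"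
    using ends deg(1) nb(1) by blast
  obtain y y' where y: "{z \<in> W. (w, z) \<in> E} - {v} \<subseteq> {y, y'}"
    using ends deg(3) nb(2) by blast
  have "card ({z \<in> W. (v, z) \<in> E} - {u, w}) = card {z \<in> W. (v, z) \<in> E} - card {u, w}"
    using assms by (intro card_Diff_subset) auto
  then have "card ({z \<in> W. (v, z) \<in> E} - {u, w}) = 1"
    using deg(2) assms(5) by (simp add: degree_in_def)
  then obtain t where t: "{z \<in> W. (v, z) \<in> E} - {u, w} = {t}"
    using card_1_singletonE by blast
  let ?m = "forbidden ?W f"
  obtain a b c where abc: "b \<in> avoiding (?m v t)"
    "a \<in> avoiding (?m u x)" "a \<in> avoiding (?m u x')" "a \<in> avoiding (\<tau> (v, u) \<circ> b)"
    "c \<in> avoiding (?m w y)" "c \<in> avoiding (?m w y')" "c \<in> avoiding (\<tau> (v, w) \<circ> b)"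
    using avoid_path[OF forbidden_permutes[OF f] forbidden_permutes[OF f] forbidden_permutes[OF f]
      forbidden_permutes[OF f] forbidden_permutes[OF f] perm[OF assms(6)] perm[OF assms(7)]] .
  have perms: "a permutes {1..4}" "b permutes {1..4}" "c permutes {1..4}"
    using abc by (auto simp: avoiding_def)
  have 1: "packing (insert v ?W) (f(v := b))"
  proof (rule packing_insert[OF f _ perms(2)])
    fix z assume z: "z \<in> ?W" "(z, v) \<in> E"
    then have "z = t"
      using t sym_E by (auto dest: symD)
    then show "disj_fun b (\<tau> (z, v) \<circ> f z)"
      using abc z by (auto simp: avoiding_def forbidden_def)
  qed simp
  have 2: "packing (insert u (insert v ?W)) (f(v := b, u := a))"
  proof (rule packing_insert[OF 1 _ perms(1)])
    fix z assume z: "z \<in> insert v ?W" "(z, u) \<in> E"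
    show "disj_fun a (\<tau> (z, u) \<circ> (f(v := b)) z)"
    proof (cases "z = v")
      case True
      then show ?thesis using abc by (simp add: avoiding_def)
    next
      case False
      then have "z = x \<or> z = x'"
        using x z sym_E by (auto dest: symD)
      then show ?thesis
        using abc z False by (auto simp: avoiding_def forbidden_def)
    qed
  qed (use ne in auto)
  have "packing (insert w (insert u (insert v ?W))) (f(v := b, u := a, w := c))"
  proof (rule packing_insert[OF 2 _ perms(3)])
    fix z assume z: "z \<in> insert u (insert v ?W)" "(z, w) \<in> E"
    have "z \<noteq> u"
      using z assms(8) by auto
    show "disj_fun c (\<tau> (z, w) \<circ> (f(v := b, u := a)) z)"
    proof (cases "z = v")
      case True
      then show ?thesis using abc ne by (simp add: avoiding_def)
    next
      case False
      then have "z = y \<or> z = y'"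
        using y z \<open>z \<noteq> u\<close> sym_E by (auto dest: symD)
      then show ?thesis
        using abc z False \<open>z \<noteq> u\<close> by (auto simp: avoiding_def forbidden_def)
    qed
  qed (use ne assms(5) in auto)
  moreover have "insert w (insert u (insert v ?W)) = W"
    using assms by auto
  ultimately show ?thesis by auto
qed

text \<open>Induction over induced subgraphs. Degrees are measured within the current
  \<open>W\<close>, which is why sparsity is required of every nonempty vertex subset.\<close>

theorem packing_exists:
  assumes sparse: "\<And>W. W \<subseteq> V \<Longrightarrow> W \<noteq> {} \<Longrightarrow> 3 * card (edges_in E W) < 5 * card W"
    and triangle_free: "\<And>u v w. (v, u) \<in> E \<Longrightarrow> (v, w) \<in> E \<Longrightarrow> (u, w) \<notin> E"
  shows "\<exists>f. packing V f"
proof -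
  have "\<exists>f. packing W f" if "W \<subseteq> V" for W
    using finite_subset[OF that finite_V] that
  proof (induction W rule: finite_psubset_induct)
    case (psubset W)
    show ?case
    proof (cases "W = {}")
      case True
      then show ?thesis by (simp add: packing_def)
    next
      case False
      show ?thesis
      proof (cases "\<exists>v\<in>W. degree_in E W v \<le> 2")
        case True
        then obtain v where v: "v \<in> W" "degree_in E W v \<le> 2" by blast
        then obtain f where "packing (W - {v}) f"
          using psubset.IH[of "W - {v}"] psubset.prems by blast
        then show ?thesis
          using extend_vertex[OF psubset.hyps v] by blast
      next
        case False
        then have "3 \<le> degree_in E W v" if "v \<in> W" for v
          using that by force
        then obtain u v w where uvw: "u \<in> W" "v \<in> W" "w \<in> W" "u \<noteq> w" "(v, u) \<in> E" "(v, w) \<in> E"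
          "degree_in E W u = 3" "degree_in E W v = 3" "degree_in E W w = 3"
          using unavoidable_configuration[OF psubset.hyps sym_E sparse[OF psubset.prems \<open>W \<noteq> {}\<close>]] by metis
        moreover obtain f where "packing (W - {u, v, w}) f"
          using psubset.IH[of "W - {u, v, w}"] psubset.prems uvw(1) by blast
        ultimately show ?thesis
          using extend_path[OF psubset.hyps uvw(1-6) triangle_free[OF uvw(5,6)] uvw(7-9)] by blast
      qed
    qed
  qed
  then show ?thesis by blast
qed

end

section \<open>Planar graphs of girth at least five\<close>

lemma girth_ge_5D:
  assumes "5 \<le> girth G" "pre_digraph.cycle (with_proj G) p" "3 \<le> length p"
  shows "5 \<le> length p"
proof -
  have "girth G \<le> enat (length p)"
    unfolding girth_def using assms(2,3) by (intro Inf_lower) auto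
  with assms(1) have "5 \<le> enat (length p)"
    by (rule order_trans)
  then show ?thesis
    by (simp add: numeral_eq_enat)
qed

context pair_graph
begin

lemma no_triangle:
  assumes "5 \<le> girth G" "(v, u) \<in> parcs G" "(v, w) \<in> parcs G"
  shows "(u, w) \<notin> parcs G"
proof
  assume uw: "(u, w) \<in> parcs G"
  have "u \<noteq> v" "w \<noteq> v" "u \<noteq> w"
    using assms(2,3) uw no_loops' by blast+
  moreover have "(w, v) \<in> parcs G"
    using assms(3) arcs_symmetric by blast
  ultimately have "cycle [(v, u), (u, w), (w, v)]"
    using assms(2) uw in_arcsD1 unfolding cycle_def awalk_def by (intro exI[of _ v]) auto
  then show False
    using girth_ge_5D[OF assms(1)] by force
qed

lemma no_4_cycle:
  assumes "5 \<le> girth G" "(a, b) \<in> parcs G" "(b, c) \<in> parcs G" "(c, d) \<in> parcs G" "(d, a) \<in> parcs G"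
  shows "a = c \<or> b = d"
proof (rule ccontr)
  assume "\<not> ?thesis"
  moreover have "a \<noteq> b" "b \<noteq> c" "c \<noteq> d" "d \<noteq> a"
    using assms no_loops' by blast+
  ultimately have "cycle [(a, b), (b, c), (c, d), (d, a)]"
    using assms in_arcsD1 unfolding cycle_def awalk_def by (intro exI[of _ a]) auto
  then show False
    using girth_ge_5D[OF assms(1)] by force
qed

text \<open>Leaf-freeness extends an edge at both ends to a walk \<open>u4\<close>,
  \<open>u2\<close>, \<open>u0\<close>, \<open>u1\<close>, \<open>u3\<close>, \<open>u5\<close>, and
  the absence of triangles and 4-cycles keeps its five edges distinct. The equality
  \<open>u4 = u5\<close> is possible and occurs for a 5-cycle.\<close>

lemma leaf_free_card_ge_5:
  assumes "5 \<le> girth G" "F \<subseteq> edges_in (parcs G) W" "leaf_free F" "F \<noteq> {}"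
  shows "5 \<le> card F"
proof -
  have sym: "(x, y) \<in> parcs G \<longleftrightarrow> (y, x) \<in> parcs G" for x y
    using arcs_symmetric by blast
  have adj: "(x, y) \<in> parcs G" if xy: "{x, y} \<in> F" for x y
  proof -
    obtain p q where "{x, y} = {p, q}" "(p, q) \<in> parcs G"
      using xy assms(2) unfolding edges_in_def by blast
    then show ?thesis
      using sym by (auto simp: doubleton_eq_iff)
  qed
  have ne: "x \<noteq> y" if "{x, y} \<in> F" for x y
    using adj[OF that] no_loops' by blast
  have next_edge: "\<exists>z. {x, z} \<in> F \<and> z \<noteq> y" if xy: "{x, y} \<in> F" for x y
  proof -
    obtain f where f: "f \<in> F" "f \<noteq> {x, y}" "x \<in> f"
      using assms(3) xy unfolding leaf_free_def by blast
    obtain p q where "f = {p, q}"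
      using f(1) assms(2) by (auto simp: edges_in_def)
    then have "\<exists>z. f = {x, z}"
      using f(3) by auto
    then show ?thesis
      using f by auto
  qed
  obtain e where "e \<in> F"
    using assms(4) by blast
  then obtain u0 u1 where 1: "{u0, u1} \<in> F"
    using assms(2) by (auto simp: edges_in_def)
  obtain u2 where 2: "{u0, u2} \<in> F" "u2 \<noteq> u1"
    using next_edge[OF 1] by blast
  obtain u3 where 3: "{u1, u3} \<in> F" "u3 \<noteq> u0"
    using next_edge[of u1 u0] 1 by (metis insert_commute)
  obtain u4 where 4: "{u2, u4} \<in> F" "u4 \<noteq> u0"
    using next_edge[of u2 u0] 2 by (metis insert_commute)
  obtain u5 where 5: "{u3, u5} \<in> F" "u5 \<noteq> u1"
    using next_edge[of u3 u1] 3 by (metis insert_commute)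
  have arcs: "(u0, u1) \<in> parcs G" "(u0, u2) \<in> parcs G" "(u1, u3) \<in> parcs G" "(u2, u4) \<in> parcs G"
    using adj 1 2 3 4 by auto
  have d1: "u3 \<noteq> u2" "u4 \<noteq> u1"
    using no_triangle[OF assms(1) arcs(1,2)] arcs(3,4) sym by blast+
  have d2: "u3 \<noteq> u4"
    using no_4_cycle[OF assms(1), of u0 u1 u3 u2] arcs sym 2(2) 3(2) by blast
  have d3: "u0 \<noteq> u1" "u0 \<noteq> u2" "u1 \<noteq> u3" "u2 \<noteq> u4" "u3 \<noteq> u5"
    using ne 1 2 3 4 5 by auto
  have "card {{u0, u1}, {u0, u2}, {u1, u3}, {u2, u4}, {u3, u5}} = 5"
    using d1 d2 d3 2(2) 3(2) 4(2) 5(2) by (auto simp: card_insert_if doubleton_eq_iff)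
  moreover have "{{u0, u1}, {u0, u2}, {u1, u3}, {u2, u4}, {u3, u5}} \<subseteq> F"
    using 1 2 3 4 5 by auto
  moreover have "F \<subseteq> Pow (pverts G)"
    using assms(2) in_arcsD1 in_arcsD2 unfolding edges_in_def by blast
  then have "finite F"
    using pair_finite_verts finite_subset by blast
  ultimately show ?thesis
    by (metis card_mono)
qed

text \<open>A drawing of \<open>G\<close> restricts to the subgraph induced by \<open>W\<close>, and
  a leaf-free edge set of that subgraph is also one of \<open>G\<close>, where the girth bounds its
  size.\<close>

lemma planar_sparse:
  assumes "planar G" "5 \<le> girth G" "W \<subseteq> pverts G" "W \<noteq> {}"
  shows "3 * card (edges_in (parcs G) W) < 5 * card W"
proof -
  obtain pos \<gamma> where "plane_drawing G pos \<gamma>"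
    using assms(1) by (auto simp: planar_def)
  then have inj: "inj_on pos (pverts G)"
    and arcs: "\<And>u v. (u, v) \<in> parcs G \<Longrightarrow> Path_Connected.arc (\<gamma> {u, v})"
      "\<And>u v. (u, v) \<in> parcs G \<Longrightarrow> {pathstart (\<gamma> {u, v}), pathfinish (\<gamma> {u, v})} = {pos u, pos v}"
      "\<And>u v w. (u, v) \<in> parcs G \<Longrightarrow> w \<in> pverts G \<Longrightarrow> pos w \<in> path_image (\<gamma> {u, v}) \<Longrightarrow> w \<in> {u, v}"
    and cross: "\<And>u v x y. (u, v) \<in> parcs G \<Longrightarrow> (x, y) \<in> parcs G \<Longrightarrow> {u, v} \<noteq> {x, y} \<Longrightarrow>
      path_image (\<gamma> {u, v}) \<inter> path_image (\<gamma> {x, y}) \<subseteq> pos ` ({u, v} \<inter> {x, y})"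
    unfolding plane_drawing_def by fast+
  interpret P: plane_graph W "edges_in (parcs G) W" pos \<gamma>
  proof
    show "finite W"
      using assms(3) pair_finite_verts finite_subset by blast
    show "inj_on pos W"
      using inj assms(3) inj_on_subset by blast
    fix e assume "e \<in> edges_in (parcs G) W"
    then obtain u v where uv: "e = {u, v}" "(u, v) \<in> parcs G" "u \<in> W" "v \<in> W"
      by (auto simp: edges_in_def)
    show "\<exists>u v. u \<noteq> v \<and> u \<in> W \<and> v \<in> W \<and> e = {u, v}"
      using uv no_loops' by blast
    show "Path_Connected.arc (\<gamma> e)" "{pathstart (\<gamma> e), pathfinish (\<gamma> e)} = pos ` e"
      using uv arcs by auto
    show "w \<in> e" if "w \<in> W" "pos w \<in> path_image (\<gamma> e)" for w
      using uv arcs(3)[of u v w] that assms(3) by auto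
    fix f assume "f \<in> edges_in (parcs G) W" "e \<noteq> f"
    then obtain x y where "f = {x, y}" "(x, y) \<in> parcs G"
      by (auto simp: edges_in_def)
    then show "path_image (\<gamma> e) \<inter> path_image (\<gamma> f) \<subseteq> pos ` (e \<inter> f)"
      using cross[OF uv(2), of x y] uv(1) \<open>e \<noteq> f\<close> by simp
  qed
  show ?thesis
    using assms(4) leaf_free_card_ge_5[OF assms(2)] by (intro P.edge_bound) auto
qed

theorem planar_girth_5_packing:
  assumes "planar G" "5 \<le> girth G" "cover 4 G D \<sigma>"
  shows "\<exists>\<Phi>. cover_packing 4 G D \<sigma> \<Phi>"
proof -
  \<comment> \<open>The orientation is erased here: an arc against it carries the inverse
    permutation, so that edge constraints can be read in either direction.\<close>
  define \<tau> where "\<tau> a = (if a \<in> D then \<sigma> a else inv (\<sigma> (snd a, fst a)))" for a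
  have D: "D \<subseteq> parcs G" "\<And>u v. (u, v) \<in> parcs G \<Longrightarrow> (u, v) \<in> D \<longleftrightarrow> (v, u) \<notin> D"
    and perm: "\<And>a. a \<in> D \<Longrightarrow> \<sigma> a permutes {1..4}"
    using assms(3) by (auto simp: cover_def orientation_def)
  interpret correspondence "pverts G" "parcs G" \<tau>
  proof
    show "finite (pverts G)"
      by (rule pair_finite_verts)
    show "sym (parcs G)"
      using arcs_symmetric by (auto intro: symI)
    show "(v, v) \<notin> parcs G" for v
      using no_loops' by blast
    show "\<tau> a permutes {1..4}" if "a \<in> parcs G" for a
    proof (cases "a \<in> D")
      case True
      then show ?thesis using perm by (simp add: \<tau>_def)
    next
      case False
      then have "(snd a, fst a) \<in> D"
        using D(2)[of "fst a" "snd a"] that by auto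
      then show ?thesis
        using perm False by (simp add: \<tau>_def permutes_inv)
    qed
    show "\<tau> (w, v) = inv (\<tau> (v, w))" if vw: "(v, w) \<in> parcs G" for v w
    proof (cases "(v, w) \<in> D")
      case True
      then show ?thesis using D(2)[OF vw] by (simp add: \<tau>_def)
    next
      case False
      then have "(w, v) \<in> D"
        using D(2)[OF vw] by blast
      then show ?thesis
        using False perm permutes_inv_inv by (metis \<tau>_def fst_conv snd_conv)
    qed
  qed
  obtain f where f: "packing (pverts G) f"
    using packing_exists planar_sparse[OF assms(1,2)] no_triangle[OF assms(2)] by blast
  have fp: "f v permutes {1..4}" if "v \<in> pverts G" for v
    using f that by (simp add: packing_def)
  have "cover_packing 4 G D \<sigma> (\<lambda>i v. f v i)"
    unfolding cover_packing_def cover_coloring_def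
  proof (intro conjI ballI impI)
    show "f v i \<in> {1..4}" if "i \<in> {1..4}" "v \<in> pverts G" for i v
      using fp[OF that(2)] that(1) permutes_in_image by metis
    show "f v i \<noteq> f v j" if "v \<in> pverts G" "i \<noteq> j" for v i j
      using permutes_inj[OF fp[OF that(1)]] that(2) by (auto simp: inj_def)
    show "case a of (v, w) \<Rightarrow> \<sigma> (v, w) (f v i) \<noteq> f w i" if "i \<in> {1..4}" "a \<in> D" for i a
    proof (cases a)
      case (Pair v w)
      then have "(v, w) \<in> parcs G"
        using that(2) D(1) by auto
      then have "disj_fun (f w) (\<tau> (v, w) \<circ> f v)"
        using f in_arcsD1 in_arcsD2 unfolding packing_def by blast
      then have "f w i \<noteq> \<tau> (v, w) (f v i)"
        using that(1) by (simp add: disj_fun_def)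
      then show ?thesis
        using Pair that(2) by (simp add: \<tau>_def eq_commute)
    qed
  qed
  then show ?thesis by blast
qed

lemma corr_packing_number_le_4:
  assumes "planar G" "5 \<le> girth G"
  shows "corr_packing_number G \<le> 4"
proof -
  have "corr_packing_number G \<le> enat 4"
    unfolding corr_packing_number_def using planar_girth_5_packing[OF assms]
    by (intro Inf_lower) auto
  then show ?thesis
    by (simp add: numeral_eq_enat)
qed

end

section \<open>The 5-cycle\<close>

definition C5 :: "nat pair_pre_digraph" where
  "C5 = \<lparr>pverts = {0, 1, 2, 3, 4},
     parcs = {(0,1), (1,2), (2,3), (3,4), (4,0), (1,0), (2,1), (3,2), (4,3), (0,4)}\<rparr>"

lemma C5_pair_graph: "pair_graph C5"
  by unfold_locales (auto simp: C5_def symmetric_def sym_def)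

lemma C5_arcs:
  "(0, y) \<in> parcs C5 \<longleftrightarrow> y = 1 \<or> y = 4"
  "(1, y) \<in> parcs C5 \<longleftrightarrow> y = 0 \<or> y = 2"
  "(2, y) \<in> parcs C5 \<longleftrightarrow> y = 1 \<or> y = 3"
  "(3, y) \<in> parcs C5 \<longleftrightarrow> y = 2 \<or> y = 4"
  "(4, y) \<in> parcs C5 \<longleftrightarrow> y = 0 \<or> y = 3"
  by (auto simp: C5_def)

lemma C5_no_triangle:
  assumes "(a, b) \<in> parcs C5" "(b, c) \<in> parcs C5" "(c, a) \<in> parcs C5"
  shows False
proof -
  have "a \<in> {0, 1, 2, 3, 4}"
    using assms(1) by (auto simp: C5_def)
  then show False
    using assms by (elim insertE emptyE; hypsubst) (auto simp: C5_arcs simp del: One_nat_def)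
qed

lemma C5_no_4_cycle:
  assumes "(a, b) \<in> parcs C5" "(b, c) \<in> parcs C5" "(c, d) \<in> parcs C5" "(d, a) \<in> parcs C5" "a \<noteq> c"
  shows "b = d"
proof -
  have "a \<in> {0, 1, 2, 3, 4}"
    using assms(1) by (auto simp: C5_def)
  then show "b = d"
    using assms by (elim insertE emptyE; hypsubst) (auto simp: C5_arcs simp del: One_nat_def)
qed

lemma C5_girth: "5 \<le> girth C5"
  unfolding girth_def
proof (rule Inf_greatest)
  fix n assume "n \<in> {enat (length p) | p. pre_digraph.cycle (with_proj C5) p \<and> 3 \<le> length p}"
  then obtain p where p: "n = enat (length p)" "pre_digraph.cycle (with_proj C5) p" "3 \<le> length p"
    by auto
  interpret pair_graph C5
    by (rule C5_pair_graph)
  obtain u where u: "pcas u p u" "set p \<subseteq> parcs C5" "distinct (tl (pawalk_verts u p))"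
    using p(2) unfolding cycle_def awalk_def by auto
  have "length p \<noteq> 3"
  proof
    assume "length p = 3"
    then obtain a b c where "p = [a, b, c]"
      by (auto simp: numeral_eq_Suc length_Suc_conv)
    then show False
      using u C5_no_triangle[of "fst a" "fst b" "fst c"] by (cases a; cases b; cases c) auto
  qed
  moreover have "length p \<noteq> 4"
  proof
    assume "length p = 4"
    then obtain a b c d where "p = [a, b, c, d]"
      by (auto simp: numeral_eq_Suc length_Suc_conv)
    then show False
      using u C5_no_4_cycle[of "fst a" "fst b" "fst c" "fst d"] by (cases a; cases b; cases c; cases d) auto
  qed
  ultimately have "5 \<le> length p"
    using p(3) by linarith
  then show "5 \<le> n"
    using p(1) by (simp add: numeral_eq_enat)
qed

section \<open>A plane drawing of the 5-cycle\<close>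

lemma C5_arc_cases:
  assumes "(u, v) \<in> parcs C5"
  obtains (segment) i where "i < 4" "{u, v} = {i, Suc i}" | (chord) "{u, v} = {0, 4}"
proof -
  have "{u, v} \<in> {{0, Suc 0}, {1, Suc 1}, {2, Suc 2}, {3, Suc 3}, {0, 4}}"
    using assms by (auto simp: C5_def)
  then show ?thesis
    using segment[of 0] segment[of 1] segment[of 2] segment[of 3] chord
    by (elim insertE emptyE) simp_all
qed

text \<open>The path \<open>0, \<dots>, 4\<close> is drawn on the real axis and closed by a half circle.\<close>
definition C5_curve :: "nat set \<Rightarrow> real \<Rightarrow> complex" where
  "C5_curve e = (if e = {0, 4} then part_circlepath 2 2 0 pi
     else linepath (of_nat (Min e)) (of_nat (Max e)))"

lemma C5_curve_segment:
  assumes "i < 4"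
  shows "C5_curve {i, Suc i} = linepath (of_nat i) (of_nat (Suc i))"
  using assms by (auto simp: C5_curve_def doubleton_eq_iff min_def max_def)

lemma C5_curve_segment_image:
  assumes "i < 4"
  shows "path_image (C5_curve {i, Suc i}) = of_real ` {real i..real (Suc i)}"
proof -
  have "path_image (C5_curve {i, Suc i}) = closed_segment (of_real (real i)) (of_real (real (Suc i)))"
    by (simp add: C5_curve_segment[OF assms])
  then show ?thesis
    unfolding closed_segment_of_real by (simp add: closed_segment_eq_real_ivl)
qed

text \<open>The point of the half circle at angle \<open>t\<close> has imaginary part
  \<open>2 * sin t\<close>, which vanishes only at the two ends.\<close>

lemma C5_curve_chord_real:
  assumes "complex_of_real x \<in> path_image (C5_curve {0, 4})"
  shows "x = 0 \<or> x = 4"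
proof -
  obtain t where t: "0 \<le> t" "t \<le> pi" "complex_of_real x = 2 + 2 * exp (\<i> * of_real t)"
    using assms by (auto simp: C5_curve_def path_image_part_circlepath closed_segment_eq_real_ivl)
  have "Im (complex_of_real x) = 2 * sin t"
    unfolding t(3) by (simp add: Im_exp)
  then have "sin t = 0"
    by simp
  then have "t = 0 \<or> t = pi"
    using t(1,2) sin_gt_zero[of t] by fastforce
  then have "complex_of_real x = of_real 4 \<or> complex_of_real x = of_real 0"
    using t(3) by auto
  then show ?thesis
    by (metis of_real_eq_iff)
qed

lemma C5_planar: "planar C5"
proof -
  have single: "arc (C5_curve {u, v})
      \<and> {pathstart (C5_curve {u, v}), pathfinish (C5_curve {u, v})} = {of_nat u, of_nat v}
      \<and> (\<forall>w\<in>pverts C5. of_nat w \<in> path_image (C5_curve {u, v}) \<longrightarrow> w \<in> {u, v})"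
    if "(u, v) \<in> parcs C5" for u v
    using that
  proof (cases rule: C5_arc_cases)
    case (segment i)
    have "{of_nat u, of_nat v} = {of_nat i, complex_of_nat (Suc i)}"
      using segment(2) by (metis image_empty image_insert)
    moreover have "complex_of_nat i \<noteq> of_nat (Suc i)"
      by (simp only: of_nat_eq_iff)
    moreover have "w \<in> {i, Suc i}" if "of_nat w \<in> path_image (C5_curve {i, Suc i})" for w
    proof -
      have "complex_of_real (real w) \<in> of_real ` {real i..real (Suc i)}"
        using that C5_curve_segment_image[OF segment(1)] by simp
      then have "real w \<in> {real i..real (Suc i)}"
        by (metis image_iff of_real_eq_iff)
      then show ?thesis by auto
    qed
    ultimately show ?thesis
      unfolding segment(2) by (simp add: C5_curve_segment[OF segment(1)] arc_linepath del: of_nat_Suc)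
  next
    case chord
    have "{of_nat u, of_nat v} = {of_nat 0, complex_of_nat 4}"
      using chord by (metis image_empty image_insert)
    moreover have "arc (C5_curve {0, 4})"
      unfolding C5_curve_def by (auto intro!: arc_part_circlepath)
    moreover have "pathstart (C5_curve {0, 4}) = 4" "pathfinish (C5_curve {0, 4}) = 0"
      by (auto simp: C5_curve_def)
    moreover have "w \<in> {0, 4}" if "of_nat w \<in> path_image (C5_curve {0, 4})" for w
      using C5_curve_chord_real[of "real w"] that by simp
    ultimately show ?thesis
      unfolding chord by auto
  qed
  have seg_seg: "path_image (C5_curve {i, Suc i}) \<inter> path_image (C5_curve {j, Suc j})
      \<subseteq> of_nat ` ({i, Suc i} \<inter> {j, Suc j})" if ij: "i < 4" "j < 4" "i < j" for i j
  proof
    fix z assume "z \<in> path_image (C5_curve {i, Suc i}) \<inter> path_image (C5_curve {j, Suc j})"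
    then obtain x where x: "z = of_real x" "x \<in> {real i..real (Suc i)}" "x \<in> {real j..real (Suc j)}"
      unfolding C5_curve_segment_image[OF ij(1)] C5_curve_segment_image[OF ij(2)] by (auto simp del: of_nat_Suc)
    then have "j = Suc i" "x = real j"
      using ij by auto
    then show "z \<in> of_nat ` ({i, Suc i} \<inter> {j, Suc j})"
      using x(1) by auto
  qed
  have seg_chord: "path_image (C5_curve {i, Suc i}) \<inter> path_image (C5_curve {0, 4})
      \<subseteq> of_nat ` ({i, Suc i} \<inter> {0, 4})" if i: "i < 4" for i
  proof
    fix z assume z: "z \<in> path_image (C5_curve {i, Suc i}) \<inter> path_image (C5_curve {0, 4})"
    then obtain x where x: "z = of_real x" "x \<in> {real i..real (Suc i)}"
      using C5_curve_segment_image[OF i] by auto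
    then have "x = 0 \<or> x = 4"
      using C5_curve_chord_real z by auto
    then have "z = of_nat 0 \<and> i = 0 \<or> z = of_nat 4 \<and> Suc i = 4"
      using x i by auto
    then show "z \<in> of_nat ` ({i, Suc i} \<inter> {0, 4})"
      by auto
  qed
  have double: "path_image (C5_curve {u, v}) \<inter> path_image (C5_curve {x, y}) \<subseteq> of_nat ` ({u, v} \<inter> {x, y})"
    if uv: "(u, v) \<in> parcs C5" and xy: "(x, y) \<in> parcs C5" and ne: "{u, v} \<noteq> {x, y}" for u v x y
    using uv
  proof (cases rule: C5_arc_cases)
    case (segment i)
    note i = this
    from xy show ?thesis
    proof (cases rule: C5_arc_cases)
      case (segment j)
      then have "i \<noteq> j"
        using ne i by auto
      then show ?thesis
        unfolding i(2) segment(2) using seg_seg[of i j] seg_seg[of j i] i(1) segment(1)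
        by (metis Int_commute nat_neq_iff)
    next
      case chord
      then show ?thesis
        unfolding i(2) using seg_chord i(1) by simp
    qed
  next
    case chord
    note c = this
    from xy show ?thesis
    proof (cases rule: C5_arc_cases)
      case (segment j)
      then show ?thesis
        unfolding c using seg_chord[of j] by (simp add: Int_commute)
    next
      case chord
      then show ?thesis
        using ne c by simp
    qed
  qed
  have "plane_drawing C5 of_nat C5_curve"
    unfolding plane_drawing_def
  proof (intro conjI)
    show "inj_on (of_nat :: nat \<Rightarrow> complex) (pverts C5)"
      by (simp add: inj_on_def)
  qed (use single double in \<open>fast+\<close>)
  then show ?thesis
    unfolding planar_def by blast
qed

section \<open>Covers of the 5-cycle without packings\<close>

definition C5_orientation :: "(nat \<times> nat) set" where
  "C5_orientation = {(0,1), (1,2), (2,3), (3,4), (4,0)}"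

lemma orientation_C5: "orientation C5 C5_orientation"
  by (auto simp: orientation_def C5_def C5_orientation_def)

text \<open>\<open>(a, b, c)\<close> is an even permutation of \<open>(1, 2, 3)\<close> iff \<open>b\<close> is the cyclic successor of
  \<open>a\<close>.\<close>
lemma disjoint_same_parity:
  fixes a b c :: nat
  assumes "{a, b, c} \<subseteq> {1..3}" "{a', b', c'} \<subseteq> {1..3}"
    "a \<noteq> b" "a \<noteq> c" "b \<noteq> c" "a' \<noteq> b'" "a' \<noteq> c'" "b' \<noteq> c'"
    "a \<noteq> a'" "b \<noteq> b'" "c \<noteq> c'"
  shows "b = a mod 3 + 1 \<longleftrightarrow> b' = a' mod 3 + 1"
proof -
  let ?S = "{1, 2, 3} :: nat set"
  have "\<forall>a\<in>?S. \<forall>b\<in>?S. a \<noteq> b \<longrightarrow> (\<forall>c\<in>?S. a \<noteq> c \<longrightarrow> b \<noteq> c \<longrightarrow>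
      (\<forall>a'\<in>?S. a \<noteq> a' \<longrightarrow> (\<forall>b'\<in>?S. a' \<noteq> b' \<longrightarrow> b \<noteq> b' \<longrightarrow>
      (\<forall>c'\<in>?S. a' \<noteq> c' \<longrightarrow> b' \<noteq> c' \<longrightarrow> c \<noteq> c' \<longrightarrow> (b = a mod 3 + 1 \<longleftrightarrow> b' = a' mod 3 + 1)))))"
    by simp
  moreover have "{1..3} = ?S"
    by auto
  then have "a \<in> ?S" "b \<in> ?S" "c \<in> ?S" "a' \<in> ?S" "b' \<in> ?S" "c' \<in> ?S"
    using assms(1,2) by blast+
  ultimately show ?thesis
    using assms(3-) by blast
qed

lemma C5_no_3_packing:
  "\<exists>\<sigma>. cover 3 C5 C5_orientation \<sigma> \<and> (\<nexists>\<Phi>. cover_packing 3 C5 C5_orientation \<sigma> \<Phi>)"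
proof (intro exI conjI)
  let ?s = "Transposition.transpose 1 (2::nat)"
  let ?\<sigma> = "\<lambda>a. if a = (4, 0) then ?s else id"
  show "cover 3 C5 C5_orientation ?\<sigma>"
    using orientation_C5 permutes_swap_id[of 1 "{1..3::nat}" 2] by (auto simp: cover_def permutes_id)
  show "\<nexists>\<Phi>. cover_packing 3 C5 C5_orientation ?\<sigma> \<Phi>"
  proof
    assume "\<exists>\<Phi>. cover_packing 3 C5 C5_orientation ?\<sigma> \<Phi>"
    then obtain \<Phi> where \<Phi>: "cover_packing 3 C5 C5_orientation ?\<sigma> \<Phi>" ..
    have range: "\<Phi> i v \<in> {1..3}" if "i \<in> {1..3}" "v \<in> pverts C5" for i v
      using \<Phi> that unfolding cover_packing_def cover_coloring_def by blast
    have dist: "\<Phi> i v \<noteq> \<Phi> j v" if "v \<in> pverts C5" "i \<in> {1..3}" "j \<in> {1..3}" "i \<noteq> j" for i j v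
      using \<Phi> that unfolding cover_packing_def by blast
    have col: "?\<sigma> (v, w) (\<Phi> i v) \<noteq> \<Phi> i w" if "i \<in> {1..3}" "(v, w) \<in> C5_orientation" for i v w
      using \<Phi> that unfolding cover_packing_def cover_coloring_def by blast
    define even where "even v \<longleftrightarrow> \<Phi> 2 v = \<Phi> 1 v mod 3 + 1" for v
    \<comment> \<open>The relabelled permutation at \<open>v\<close> is disjoint from the one at
      \<open>w\<close>, so both have the same parity. Along an arc labelled by the identity, parity
      carries over unchanged.\<close>
    have step: "?\<sigma> (v, w) (\<Phi> 2 v) = ?\<sigma> (v, w) (\<Phi> 1 v) mod 3 + 1 \<longleftrightarrow> even w"
      if vw: "(v, w) \<in> C5_orientation" for v w
    proof -
      have V: "v \<in> pverts C5" "w \<in> pverts C5"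
        using vw by (auto simp: C5_def C5_orientation_def)
      have \<sigma>: "?\<sigma> (v, w) permutes {1..3}"
        using permutes_swap_id[of 1 "{1..3::nat}" 2] by auto
      have i: "1 \<in> {1..3::nat}" "2 \<in> {1..3::nat}" "3 \<in> {1..3::nat}"
        by auto
      have "?\<sigma> (v, w) (\<Phi> i v) \<in> {1..3}" if "i \<in> {1..3}" for i
        using permutes_in_image[OF \<sigma>] range[OF that V(1)] by blast
      moreover have "?\<sigma> (v, w) (\<Phi> i v) \<noteq> ?\<sigma> (v, w) (\<Phi> j v)"
        if "i \<in> {1..3}" "j \<in> {1..3}" "i \<noteq> j" for i j
        using dist[OF V(1) that] permutes_inj[OF \<sigma>] by (metis injD)
      ultimately show ?thesis
        unfolding even_def using i range[OF _ V(2)] dist[OF V(2)] col[OF _ vw]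
        by (intro disjoint_same_parity[of _ _ "?\<sigma> (v, w) (\<Phi> 3 v)" _ _ "\<Phi> 3 w"]) simp_all
    qed
    have "even 4 \<longleftrightarrow> even 0"
      using step[of 0 1] step[of 1 2] step[of 2 3] step[of 3 4]
      by (simp add: C5_orientation_def even_def)
    moreover have "?s (\<Phi> 2 4) = ?s (\<Phi> 1 4) mod 3 + 1 \<longleftrightarrow> even 0"
      using step[of 4 0] by (simp add: C5_orientation_def)
    \<comment> \<open>A transposition is odd: it exchanges cyclic successors and predecessors, and
      of two distinct elements of \<open>{1..3}\<close> the second is one or the other. The arc
      \<open>(4, 0)\<close> therefore flips the parity that the other four arcs preserve.\<close>
    moreover have "?s b = ?s a mod 3 + 1 \<longleftrightarrow> b \<noteq> a mod 3 + 1"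
      if "a \<in> {1..3}" "b \<in> {1..3}" "a \<noteq> b" for a b :: nat
    proof -
      have "{1..3} = {1, 2, 3::nat}" by auto
      then show ?thesis
        using that by (auto simp: Transposition.transpose_def)
    qed
    from this[of "\<Phi> 1 4" "\<Phi> 2 4"]
    have "?s (\<Phi> 2 4) = ?s (\<Phi> 1 4) mod 3 + 1 \<longleftrightarrow> \<not> even 4"
      unfolding even_def using range[of 1 4] range[of 2 4] dist[of 4 1 2] by (simp add: C5_def)
    ultimately show False
      by blast
  qed
qed

text \<open>The packing number is an infimum over all \<open>k\<close>, so values below three are
  excluded one by one. Under identity permutations a coloring is a proper one, and an odd cycle has
  none with two colours.\<close>

lemma C5_no_2_packing:
  "\<exists>\<sigma>. cover 2 C5 C5_orientation \<sigma> \<and> (\<nexists>\<Phi>. cover_packing 2 C5 C5_orientation \<sigma> \<Phi>)"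
proof (intro exI conjI)
  show "cover 2 C5 C5_orientation (\<lambda>_. id)"
    using orientation_C5 by (simp add: cover_def)
  show "\<nexists>\<Phi>. cover_packing 2 C5 C5_orientation (\<lambda>_. id) \<Phi>"
  proof
    assume "\<exists>\<Phi>. cover_packing 2 C5 C5_orientation (\<lambda>_. id) \<Phi>"
    then obtain \<Phi> where "cover_packing 2 C5 C5_orientation (\<lambda>_. id) \<Phi>" ..
    then have c: "cover_coloring 2 C5 C5_orientation (\<lambda>_. id) (\<Phi> 1)"
      by (simp add: cover_packing_def)
    have "\<Phi> 1 v = 1 \<or> \<Phi> 1 v = 2" if "v \<in> pverts C5" for v
    proof -
      have "\<Phi> 1 v \<in> {1..2}"
        using c that unfolding cover_coloring_def by blast
      then show ?thesis by auto
    qed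
    then have "\<Phi> 1 0 = 1 \<or> \<Phi> 1 0 = 2" "\<Phi> 1 1 = 1 \<or> \<Phi> 1 1 = 2" "\<Phi> 1 2 = 1 \<or> \<Phi> 1 2 = 2"
      "\<Phi> 1 3 = 1 \<or> \<Phi> 1 3 = 2" "\<Phi> 1 4 = 1 \<or> \<Phi> 1 4 = 2"
      by (simp_all add: C5_def)
    moreover have "\<Phi> 1 0 \<noteq> \<Phi> 1 1" "\<Phi> 1 1 \<noteq> \<Phi> 1 2" "\<Phi> 1 2 \<noteq> \<Phi> 1 3" "\<Phi> 1 3 \<noteq> \<Phi> 1 4" "\<Phi> 1 4 \<noteq> \<Phi> 1 0"
      using c by (simp_all add: cover_coloring_def C5_orientation_def)
    ultimately show False
      by metis
  qed
qed

lemma C5_no_1_packing: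
  "\<exists>\<sigma>. cover 1 C5 C5_orientation \<sigma> \<and> (\<nexists>\<Phi>. cover_packing 1 C5 C5_orientation \<sigma> \<Phi>)"
proof (intro exI conjI)
  show "cover 1 C5 C5_orientation (\<lambda>_. id)"
    using orientation_C5 by (simp add: cover_def)
  show "\<nexists>\<Phi>. cover_packing 1 C5 C5_orientation (\<lambda>_. id) \<Phi>"
    by (auto simp: cover_packing_def cover_coloring_def C5_orientation_def C5_def)
qed

lemma C5_corr_packing_number: "4 \<le> corr_packing_number C5"
  unfolding corr_packing_number_def
proof (rule Inf_greatest)
  fix n assume "n \<in> {enat k | k. 1 \<le> k \<and> (\<forall>D \<sigma>. cover k C5 D \<sigma> \<longrightarrow> (\<exists>\<Phi>. cover_packing k C5 D \<sigma> \<Phi>))}"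
  then obtain k where k: "n = enat k" "1 \<le> k"
    "\<And>D \<sigma>. cover k C5 D \<sigma> \<Longrightarrow> \<exists>\<Phi>. cover_packing k C5 D \<sigma> \<Phi>"
    by blast
  have "k \<noteq> 1" "k \<noteq> 2" "k \<noteq> 3"
    using k(3) C5_no_1_packing C5_no_2_packing C5_no_3_packing by blast+
  then have "4 \<le> k"
    using k(2) by linarith
  then show "4 \<le> n"
    using k(1) by (simp add: numeral_eq_enat)
qed

theorem theorem3:
  shows "(\<forall>G :: 'a pair_pre_digraph.
            pair_graph G \<and> planar G \<and> 5 \<le> girth G \<longrightarrow> corr_packing_number G \<le> 4) \<and>
         (\<exists>H :: nat pair_pre_digraph.
            pair_graph H \<and> planar H \<and> 5 \<le> girth H \<and> corr_packing_number H = 4)"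
proof (intro conjI allI impI)
  show "corr_packing_number G \<le> 4" if "pair_graph G \<and> planar G \<and> 5 \<le> girth G"
    for G :: "'a pair_pre_digraph"
    using that pair_graph.corr_packing_number_le_4 by blast
  have "corr_packing_number C5 = 4"
    using pair_graph.corr_packing_number_le_4[OF C5_pair_graph C5_planar C5_girth]
      C5_corr_packing_number by (rule antisym)
  then show "\<exists>H :: nat pair_pre_digraph.
      pair_graph H \<and> planar H \<and> 5 \<le> girth H \<and> corr_packing_number H = 4"
    using C5_pair_graph C5_planar C5_girth by blast
qed

end
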